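(* Let $\mu$ be the Möbius function and let $(X,T)$ be a uniquely weakly mixing dynamical system with invariant probability measure $P$. Then for every $f\in C_0(X)$ and every $x\in X$, $$\frac1N\sum_{n=1}^{N}f(T^n x)\,\mu^2(n)\longrightarrow 0\quad\text{as } N\to+\infty .$$
   Context: The Möbius function is $\mu(1)=1$, $\mu(n)=(-1)^r$ if $n$ is a product of $r$ distinct primes, and $\mu(n)=0$ otherwise; $\mu^2(n)=\mu(n)^2$. $X$ is a compact metric space and $T:X\to X$ is a homeomorphism. For a $T$-invariant Borel probability measure $P$ and $f\in L^2(X,P)$, the spectral measure $\sigma_f$ is the finite positive measure on the circle $\mathbb{R}/2\pi\mathbb{Z}$ with $\int e^{-ikx}\,d\sigma_f(x)=\int_X f\circ T^k\cdot\overline f\,dP$ for all $k\in\mathbb{Z}$. The maximal spectral type is the equivalence class of a measure $\sigma_{f_1}$ ($f_1\in L^2(X,P)$) with respect to which all $\sigma_f$, $f\in L^2(X,P)$, are absolutely continuous. $(X,T)$ is uniquely weakly mixing if there is a unique ergodic $T$-invariant Borel probability measure $P$ on $X$ and $\sigma_{f_1}$ is (up to equivalence of measures) the sum of the Dirac measure at $0$ (the angle $0$) and a continuous (i.e. atomless) measure. $C_0(X)$ is the set of continuous complex-valued functions $f$ on $X$ with zero mean, $\int f\,dP=0$. *)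

theory Defs
  imports "HOL-Probability.Probability" "HOL-Computational_Algebra.Squarefree"
begin

definition moebius :: "nat \<Rightarrow> int" where
  "moebius n = (if squarefree n then (-1) ^ card (prime_factors n) else 0)"

lemma moebius_prod_distinct_primes:
  assumes "finite S" and "\<And>p. p \<in> S \<Longrightarrow> prime p"
  shows "moebius (\<Prod>S) = (-1) ^ card S"
proof -
  have "0 \<notin> S" using assms(2) not_prime_0 by blast
  then have pf: "prime_factors (\<Prod>S) = S"
    using assms by (subst prime_factors_prod) (auto simp: prime_prime_factors)
  have "squarefree (\<Prod>S)"
    using assms
    by (intro squarefree_prod_coprime) (auto intro: primes_coprime squarefree_prime)
  then show ?thesis
    by (simp add: moebius_def pf)
qed

lemma moebius_eq_0:
  assumes "\<nexists>S. finite S \<and> (\<forall>p\<in>S. prime p) \<and> n = \<Prod>S"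
  shows "moebius n = 0"
proof (rule ccontr)
  assume "moebius n \<noteq> 0"
  then have sq: "squarefree n" by (auto simp: moebius_def split: if_splits)
  then have "n \<noteq> 0" by (metis not_squarefree_0)
  then have "n = (\<Prod>p\<in>prime_factors n. p ^ multiplicity p n)"
    by (simp add: prod_prime_factors)
  also have "\<dots> = \<Prod>(prime_factors n)"
    using sq \<open>n \<noteq> 0\<close> by (intro prod.cong) (auto simp: squarefree_factorial_semiring')
  finally show False using assms by blast
qed

definition invariant_prob :: "('a::metric_space \<Rightarrow> 'a) \<Rightarrow> 'a measure \<Rightarrow> bool" where
  "invariant_prob T P \<longleftrightarrow> sets P = sets borel \<and> prob_space P \<and> distr P borel T = P"

definition ergodic_prob :: "('a::metric_space \<Rightarrow> 'a) \<Rightarrow> 'a measure \<Rightarrow> bool" where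
  "ergodic_prob T P \<longleftrightarrow> invariant_prob T P \<and>
     (\<forall>A\<in>sets borel. T -` A = A \<longrightarrow> measure P A = 0 \<or> measure P A = 1)"

text \<open>Functions of class L2 are taken as everywhere defined representatives; the integrals
  below depend only on their class modulo equality almost everywhere.\<close>

definition L2 :: "'a measure \<Rightarrow> ('a \<Rightarrow> complex) set" where
  "L2 P = {f. f \<in> borel_measurable P \<and> integrable P (\<lambda>x. (cmod (f x))\<^sup>2)}"

text \<open>The k-th iterate of a bijection, with negative k iterating the inverse.\<close>

definition iterate_int :: "('a \<Rightarrow> 'a) \<Rightarrow> int \<Rightarrow> 'a \<Rightarrow> 'a" where
  "iterate_int T k = (if k \<ge> 0 then T ^^ nat k else inv T ^^ nat (- k))"

text \<open>The circle of angles modulo \<open>2\<pi>\<close>, represented by the fundamental domain \<open>[0, 2\<pi>)\<close>. The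
  quotient map restricts to a Borel isomorphism from this interval (with the Borel sets of
  the line) onto the circle, so finite Borel measures and their atoms are the same.\<close>

definition circle :: "real measure" where
  "circle = restrict_space borel {0..<2 * pi}"

definition is_spectral_measure ::
    "('a \<Rightarrow> 'a) \<Rightarrow> 'a measure \<Rightarrow> ('a \<Rightarrow> complex) \<Rightarrow> real measure \<Rightarrow> bool" where
  "is_spectral_measure T P f \<sigma> \<longleftrightarrow>
     sets \<sigma> = sets circle \<and> finite_measure \<sigma> \<and>
     (\<forall>k::int. (LINT t|\<sigma>. exp (- \<i> * of_int k * complex_of_real t)) =
               (LINT x|P. f (iterate_int T k x) * cnj (f x)))"

text \<open>Note the argument order of the library: \<open>absolutely_continuous \<sigma> \<tau>\<close> says that \<open>\<tau>\<close> is
  absolutely continuous with respect to \<open>\<sigma>\<close>. The following says that \<open>\<sigma>\<close> is a spectral measure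
  representing the maximal spectral type.\<close>

definition is_maximal_spectral_measure ::
    "('a \<Rightarrow> 'a) \<Rightarrow> 'a measure \<Rightarrow> real measure \<Rightarrow> bool" where
  "is_maximal_spectral_measure T P \<sigma> \<longleftrightarrow>
     (\<exists>f\<^sub>1\<in>L2 P. is_spectral_measure T P f\<^sub>1 \<sigma>) \<and>
     (\<forall>f\<in>L2 P. \<forall>\<tau>. is_spectral_measure T P f \<tau> \<longrightarrow> absolutely_continuous \<sigma> \<tau>)"

definition equivalent_measures :: "'b measure \<Rightarrow> 'b measure \<Rightarrow> bool" where
  "equivalent_measures M N \<longleftrightarrow> absolutely_continuous M N \<and> absolutely_continuous N M"

definition continuous_circle_measure :: "real measure \<Rightarrow> bool" where
  "continuous_circle_measure \<nu> \<longleftrightarrow>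
     sets \<nu> = sets circle \<and> finite_measure \<nu> \<and> (\<forall>t\<in>space circle. emeasure \<nu> {t} = 0)"

text \<open>The continuous part \<open>\<nu>\<close> may be zero, as it is for the system with one point.\<close>

definition dirac_plus_continuous :: "real measure \<Rightarrow> bool" where
  "dirac_plus_continuous \<kappa> \<longleftrightarrow>
     sets \<kappa> = sets circle \<and>
     (\<exists>\<nu>. continuous_circle_measure \<nu> \<and>
          (\<forall>A\<in>sets circle. emeasure \<kappa> A = emeasure (return circle 0) A + emeasure \<nu> A))"

definition uniquely_weakly_mixing :: "('a::metric_space \<Rightarrow> 'a) \<Rightarrow> 'a measure \<Rightarrow> bool" where
  "uniquely_weakly_mixing T P \<longleftrightarrow>
     ergodic_prob T P \<and> (\<forall>Q. ergodic_prob T Q \<longrightarrow> Q = P) \<and>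
     (\<exists>\<sigma> \<kappa>. is_maximal_spectral_measure T P \<sigma> \<and> dirac_plus_continuous \<kappa> \<and>
            equivalent_measures \<sigma> \<kappa>)"

definition C0 :: "'a::metric_space measure \<Rightarrow> ('a \<Rightarrow> complex) set" where
  "C0 P = {f. continuous_on UNIV f \<and> (LINT x|P. f x) = 0}"

end

theory Submission
  imports Defs
begin

text \<open>The indicator of the squarefree numbers is approximated, up to a set of density at most
  \<open>1 / D\<close>, by the periodic indicator of the numbers divisible by no \<open>d\<^sup>2\<close> with \<open>2 \<le> d \<le> D\<close>. So it
  suffices that the averages of \<open>f\<close> along every power \<open>T\<^sup>M\<close> tend to the integral of \<open>f\<close>, uniformly on
  the space, that is, that \<open>T\<^sup>M\<close> is uniquely ergodic. An ergodic measure of \<open>T\<^sup>M\<close>, averaged over its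
  first \<open>M\<close> images under \<open>T\<close>, is ergodic for \<open>T\<close> and hence equal to \<open>P\<close>; and \<open>P\<close> is ergodic for \<open>T\<^sup>M\<close>,
  since an invariant set of \<open>T\<^sup>M\<close> that is not one of \<open>T\<close> yields an eigenfunction of \<open>T\<close> with eigenvalue
  a nontrivial root of unity, whose spectral measure is a point mass excluded by weak mixing. Finally
  a continuous \<open>g\<close> has an ergodic measure at which its integral equals the infimum over continuous
  \<open>u\<close> of the supremum of \<open>g + u - u \<circ> T\<^sup>M\<close>, which bounds all its averages.\<close>

section \<open>Extreme dominated functionals\<close>

text \<open>Uniqueness is assumed for ergodic measures only, so a measure that is merely invariant,
  such as a limit of averages, cannot be compared with \<open>P\<close> directly: the maximizing
  measure has to come out ergodic. That is why an extreme functional is chosen and only then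
  represented by a measure. An ergodic measure of \<open>T ^^ M\<close> is identified with
  \<open>P\<close> through domination: it is at most \<open>M\<close> times the average of its
  images, which is \<open>P\<close>, so it is absolutely continuous with respect to
  \<open>P\<close>; and an ergodic measure dominates no invariant probability measure but itself.
  The density \<open>1 / D\<close> is the tail beyond \<open>D\<close> of the sum of 1 / d^2. The
  period of the approximating weight is (D!)^2, and \<open>D\<close> is fixed before
  \<open>N\<close> grows, so constants that depend on the period are harmless.\<close>

definition sublinear :: "('v::real_vector \<Rightarrow> real) \<Rightarrow> bool" where
  "sublinear p \<longleftrightarrow> (\<forall>x y. p (x + y) \<le> p x + p y) \<and> (\<forall>c x. 0 \<le> c \<longrightarrow> p (c *\<^sub>R x) = c * p x)"

lemma sublinear_add: "sublinear p \<Longrightarrow> p (x + y) \<le> p x + p y"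
  by (simp add: sublinear_def)

lemma sublinear_scale: "sublinear p \<Longrightarrow> 0 \<le> c \<Longrightarrow> p (c *\<^sub>R x) = c * p x"
  by (simp add: sublinear_def)

lemma sublinear_zero: "sublinear p \<Longrightarrow> p 0 = 0"
  using sublinear_scale[of p 0 0] by simp

lemma sublinear_minus_ge: "sublinear p \<Longrightarrow> - p (- x) \<le> p x"
  using sublinear_add[of p x "- x"] sublinear_zero[of p] by simp

text \<open>Serves for tilts, for infima of chains and for \<open>coboundary_sup\<close>. A single
  \<open>q i\<close> need not be sublinear, since the index may move along with the argument.
  Homogeneity is asked as an inequality only: applied to \<open>inverse c\<close> it yields its own
  converse.\<close>

lemma sublinear_INF:
  assumes ne: "I \<noteq> {}" and bdd: "\<And>x. bdd_below ((\<lambda>i. q i x) ` I)"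
    and hom: "\<And>i c x. i \<in> I \<Longrightarrow> 0 < c \<Longrightarrow> \<exists>j\<in>I. q j (c *\<^sub>R x) \<le> c * q i x"
    and add: "\<And>i j x y. i \<in> I \<Longrightarrow> j \<in> I \<Longrightarrow> \<exists>k\<in>I. q k (x + y) \<le> q i x + q j y"
    and zero: "(INF i\<in>I. q i 0) = 0"
  shows "sublinear (\<lambda>x. INF i\<in>I. q i x)"
  unfolding sublinear_def
proof (intro conjI allI impI)
  fix x y
  let ?Q = "\<lambda>x. INF i\<in>I. q i x"
  have "?Q (x + y) - q i x \<le> q j y" if "i \<in> I" "j \<in> I" for i j
    using add[OF that, of x y] cINF_lower[OF bdd[of "x + y"]] by fastforce
  then have "?Q (x + y) - q i x \<le> ?Q y" if "i \<in> I" for i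
    by (intro cINF_greatest ne) (use that in auto)
  then have "?Q (x + y) - ?Q y \<le> ?Q x"
    by (intro cINF_greatest ne) (auto simp: algebra_simps)
  then show "?Q (x + y) \<le> ?Q x + ?Q y" by simp
next
  fix c :: real and x
  let ?Q = "\<lambda>x. INF i\<in>I. q i x"
  assume c: "0 \<le> c"
  have le: "?Q (d *\<^sub>R z) \<le> d * ?Q z" if d: "0 < d" for d z
  proof -
    have "?Q (d *\<^sub>R z) / d \<le> q i z" if "i \<in> I" for i
      using hom[OF that d, of z] cINF_lower[OF bdd[of "d *\<^sub>R z"]] d
      by (fastforce simp: field_simps)
    then have "?Q (d *\<^sub>R z) / d \<le> ?Q z"
      by (intro cINF_greatest ne) auto
    then show ?thesis using d by (simp add: field_simps)
  qed
  show "?Q (c *\<^sub>R x) = c * ?Q x"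
  proof (cases "c = 0")
    case True
    then show ?thesis using zero by simp
  next
    case False
    then have "0 < c" using c by simp
    moreover have "?Q x \<le> inverse c * ?Q (c *\<^sub>R x)"
      using le[of "inverse c" "c *\<^sub>R x"] \<open>0 < c\<close> by simp
    ultimately show ?thesis using le[of c x] by (simp add: field_simps antisym)
  qed
qed

text \<open>The directional derivative of \<open>q\<close> at \<open>g\<close>, taken at infinity rather than at \<open>0\<^sup>+\<close> (these agree by
  homogeneity); it is the support functional of the face of \<open>q\<close> on which \<open>g\<close> is maximal.\<close>

definition tilt :: "('v::real_vector \<Rightarrow> real) \<Rightarrow> 'v \<Rightarrow> 'v \<Rightarrow> real" where
  "tilt q g h = (INF t\<in>{0..}. q (t *\<^sub>R g + h) - t * q g)"

lemma bdd_below_tilt: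
  assumes "sublinear q"
  shows "bdd_below ((\<lambda>t. q (t *\<^sub>R g + h) - t * q g) ` {0..})"
proof (rule bdd_belowI2)
  fix t :: real assume "t \<in> {0..}"
  then show "- q (- h) \<le> q (t *\<^sub>R g + h) - t * q g"
    using sublinear_add[OF assms, of "t *\<^sub>R g + h" "- h"] sublinear_scale[OF assms, of t g] by simp
qed

lemma tilt_le: "sublinear q \<Longrightarrow> 0 \<le> t \<Longrightarrow> tilt q g h \<le> q (t *\<^sub>R g + h) - t * q g"
  unfolding tilt_def by (intro cINF_lower bdd_below_tilt) auto

lemma sublinear_tilt:
  assumes q: "sublinear q"
  shows "sublinear (tilt q g)"
proof -
  have "sublinear (\<lambda>h. INF t\<in>{0..}. q (t *\<^sub>R g + h) - t * q g)"
  proof (rule sublinear_INF)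
    fix t c :: real and x assume "t \<in> {0..}" "0 < c"
    then show "\<exists>s\<in>{0..}. q (s *\<^sub>R g + c *\<^sub>R x) - s * q g \<le> c * (q (t *\<^sub>R g + x) - t * q g)"
      using sublinear_scale[OF q, of c "t *\<^sub>R g + x"]
      by (intro bexI[of _ "c * t"]) (auto simp: algebra_simps)
  next
    fix s t :: real and x y assume "s \<in> {0..}" "t \<in> {0..}"
    then show "\<exists>r\<in>{0..}. q (r *\<^sub>R g + (x + y)) - r * q g
        \<le> q (s *\<^sub>R g + x) - s * q g + (q (t *\<^sub>R g + y) - t * q g)"
      using sublinear_add[OF q, of "s *\<^sub>R g + x" "t *\<^sub>R g + y"]
      by (intro bexI[of _ "s + t"]) (auto simp: algebra_simps)
  qed (use bdd_below_tilt[OF q] sublinear_scale[OF q] in auto)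
  then show ?thesis by (simp add: tilt_def[abs_def])
qed

text \<open>In convex geometry: the linear functionals below \<open>q\<close> form an extreme subset
  of those below \<open>p\<close>. A set of functionals is handled through its support function, so
  that shrinking the set means lowering \<open>q\<close>.\<close>

definition face :: "('v::real_vector \<Rightarrow> real) \<Rightarrow> ('v \<Rightarrow> real) \<Rightarrow> bool" where
  "face p q \<longleftrightarrow> (\<forall>L M t. linear L \<longrightarrow> linear M \<longrightarrow> L \<le> p \<longrightarrow> M \<le> p \<longrightarrow> 0 < t \<longrightarrow> t < 1 \<longrightarrow>
     (\<forall>x. t * L x + (1 - t) * M x \<le> q x) \<longrightarrow> L \<le> q \<and> M \<le> q)"

text \<open>The entries at 0 and 1 of the tilt force the combination below \<open>q\<close> and its
  value at \<open>g\<close> up to \<open>q g\<close>. Two numbers that are at most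
  \<open>q g\<close> average to \<open>q g\<close> only if both equal it, and a functional below
  \<open>q\<close> with value \<open>q g\<close> at \<open>g\<close> lies below every entry of the
  tilt.\<close>

lemma face_tilt:
  assumes q: "sublinear q" and f: "face p q"
  shows "face p (tilt q g)"
  unfolding face_def
proof (intro allI impI)
  fix L M :: "'a \<Rightarrow> real" and t :: real
  assume LM: "linear L" "linear M" "L \<le> p" "M \<le> p" and t: "0 < t" "t < 1"
    and le: "\<forall>x. t * L x + (1 - t) * M x \<le> tilt q g x"
  have "\<forall>x. t * L x + (1 - t) * M x \<le> q x"
    using order_trans[OF spec[OF le] tilt_le[OF q, of 0 g]] by simp
  then have Lq: "L \<le> q" and Mq: "M \<le> q" using f LM t unfolding face_def by blast+
  have "t * L (- g) + (1 - t) * M (- g) \<le> - q g"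
    using order_trans[OF spec[OF le, of "- g"] tilt_le[OF q, of 1 g "- g"]] sublinear_zero[OF q]
    by simp
  then have ge: "q g \<le> t * L g + (1 - t) * M g"
    using LM by (simp add: linear_neg)
  have lg: "L g \<le> q g" "M g \<le> q g" using Lq Mq by (auto simp: le_fun_def)
  have "t * L g \<le> t * q g" "(1 - t) * M g \<le> (1 - t) * q g"
    using lg t by (auto intro: mult_left_mono)
  then have "t * q g \<le> t * L g" "(1 - t) * q g \<le> (1 - t) * M g"
    using ge by (auto simp: algebra_simps)
  then have eq: "L g = q g" "M g = q g" using lg t by (auto simp: antisym)
  have "K h \<le> tilt q g h" if K: "linear K" "K \<le> q" "K g = q g" for K h
    unfolding tilt_def
  proof (rule cINF_greatest)
    fix s :: real assume "s \<in> {0..}"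
    have "K (s *\<^sub>R g + h) \<le> q (s *\<^sub>R g + h)" using K(2) by (auto simp: le_fun_def)
    then show "K h \<le> q (s *\<^sub>R g + h) - s * q g"
      using K by (simp add: linear_add linear_scale)
  qed simp
  then show "L \<le> tilt q g \<and> M \<le> tilt q g"
    using LM Lq Mq eq by (auto simp: le_fun_def)
qed

text \<open>An extreme point of the set of linear functionals dominated by \<open>p\<close>, maximal at \<open>g\<close>. Among the
  sublinear functionals whose dominated linear functionals form a face, a minimal one equals each of
  its own tilts, hence is linear; this replaces the theorems of Hahn-Banach and Krein-Milman.\<close>

theorem extreme_dominated_functional:
  fixes p :: "'v::real_vector \<Rightarrow> real"
  assumes p: "sublinear p"
  obtains L where "linear L" "L \<le> p" "L g = p g"
    "\<forall>L1 L2 t. linear L1 \<and> linear L2 \<and> L1 \<le> p \<and> L2 \<le> p \<and> 0 < t \<and> t < 1 \<and>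
       (\<forall>x. L x = t * L1 x + (1 - t) * L2 x) \<longrightarrow> L1 = L"
proof -
  \<comment> \<open>The condition at \<open>- g\<close> records maximality at \<open>g\<close> in a
    form that survives lowering \<open>q\<close>: a linear functional below \<open>q\<close> has
    value at least \<open>p g\<close> at \<open>g\<close>.\<close>
  define A where "A = {q. sublinear q \<and> q \<le> p \<and> q (- g) \<le> - p g \<and> face p q}"
  define R where "R = (\<lambda>q r :: 'v \<Rightarrow> real. r \<le> q)"
  have "face p p" by (simp add: face_def)
  then have "face p (tilt p g)" by (rule face_tilt[OF p])
  then have top: "tilt p g \<in> A"
    using sublinear_tilt[OF p] tilt_le[OF p, of 0 g] tilt_le[OF p, of 1 g "- g"] sublinear_zero[OF p]
    by (simp add: A_def le_fun_def)
  have "\<exists>m\<in>A. \<forall>a\<in>A. R m a \<longrightarrow> a = m"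
  proof (rule predicate_Zorn)
    show "partial_order_on A (relation_of R A)"
      by (rule partial_order_on_relation_ofI) (auto simp: R_def)
  next
    fix C assume C: "C \<in> Chains (relation_of R A)"
    then have CA: "C \<subseteq> A" and ch: "\<And>q r. q \<in> C \<Longrightarrow> r \<in> C \<Longrightarrow> q \<le> r \<or> r \<le> q"
      by (auto simp: Chains_def relation_of_def R_def)
    show "\<exists>u\<in>A. \<forall>a\<in>C. R a u"
    proof (cases "C = {}")
      case True then show ?thesis using top by auto
    next
      case False
      define u where "u x = (INF q\<in>C. q x)" for x
      have bdd: "bdd_below ((\<lambda>q. q x) ` C)" for x
      proof (rule bdd_belowI2)
        fix q assume "q \<in> C"
        then have "sublinear q" "q (- x) \<le> p (- x)" using CA by (auto simp: A_def le_fun_def)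
        then show "- p (- x) \<le> q x" using sublinear_minus_ge[of q x] by linarith
      qed
      have lower: "u \<le> q" if "q \<in> C" for q
        unfolding u_def le_fun_def using cINF_lower[OF bdd that] by auto
      have "sublinear (\<lambda>x. INF q\<in>C. q x)"
      proof (rule sublinear_INF[OF False bdd])
        fix q r x y assume qr: "q \<in> C" "r \<in> C"
        then have "sublinear q" "sublinear r" using CA by (auto simp: A_def)
        then have "q (x + y) \<le> q x + q y" "r (x + y) \<le> r x + r y"
          by (auto intro: sublinear_add)
        \<comment> \<open>Of two members of a chain the smaller one serves for both arguments, which
          gives subadditivity of the infimum.\<close>
        moreover have "q x \<le> r x \<and> q y \<le> r y \<or> r x \<le> q x \<and> r y \<le> q y"
          using ch[OF qr] by (auto simp: le_fun_def)
        ultimately have "q (x + y) \<le> q x + r y \<or> r (x + y) \<le> q x + r y" by linarith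
        then show "\<exists>s\<in>C. s (x + y) \<le> q x + r y" using qr by blast
      next
        fix q c x assume "q \<in> C" and c: "(0::real) < c"
        moreover from this have "q (c *\<^sub>R x) = c * q x"
          using CA by (intro sublinear_scale) (auto simp: A_def)
        ultimately show "\<exists>r\<in>C. r (c *\<^sub>R x) \<le> c * q x"
          by (intro bexI[of _ q]) auto
      next
        have "(INF q\<in>C. q 0) = (INF q\<in>C. 0)"
          using CA by (intro INF_cong) (auto simp: A_def sublinear_zero)
        then show "(INF q\<in>C. q 0) = 0" using False by simp
      qed
      then have sub: "sublinear u" by (simp add: u_def[abs_def])
      obtain q0 where q0: "q0 \<in> C" using False by blast
      then have "q0 \<le> p" "q0 (- g) \<le> - p g" using CA by (auto simp: A_def)
      then have "u \<le> p" "u (- g) \<le> - p g"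
        using lower[OF q0] le_funD[OF lower[OF q0], of "- g"] by auto
      moreover have "face p u"
        unfolding face_def
      proof (intro allI impI)
        fix L M :: "'v \<Rightarrow> real" and t :: real
        assume LM: "linear L" "linear M" "L \<le> p" "M \<le> p" "0 < t" "t < 1"
          and le: "\<forall>x. t * L x + (1 - t) * M x \<le> u x"
        have "L \<le> q \<and> M \<le> q" if "q \<in> C" for q
        proof -
          have "face p q" using that CA by (auto simp: A_def)
          moreover have "\<forall>x. t * L x + (1 - t) * M x \<le> q x"
            using order_trans[OF spec[OF le] le_funD[OF lower[OF that]]] by blast
          ultimately show ?thesis using LM unfolding face_def by blast
        qed
        then show "L \<le> u \<and> M \<le> u"
          unfolding u_def le_fun_def using False by (auto intro!: cINF_greatest)
      qed
      ultimately have "u \<in> A" using sub by (simp add: A_def)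
      then show ?thesis using lower by (auto simp: R_def)
    qed
  qed
  then obtain m where m: "m \<in> A" and min: "\<And>a. a \<in> A \<Longrightarrow> a \<le> m \<Longrightarrow> a = m"
    by (auto simp: R_def)
  have sub: "sublinear m" and mp: "m \<le> p" and mg: "m (- g) \<le> - p g" and f: "face p m"
    using m by (auto simp: A_def)
  have neg: "m (- h) = - m h" for h
  proof -
    \<comment> \<open>The tilt stays in \<open>A\<close>, so minimality makes it equal to
      \<open>m\<close>. Its entry at parameter 1, evaluated at \<open>- h\<close>, is
      \<open>- m h\<close>; this is the inequality that sublinearity lacks for oddness.\<close>
    have le: "tilt m h \<le> m" using tilt_le[OF sub, of 0 h] by (simp add: le_fun_def)
    then have "tilt m h \<in> A"
      using sublinear_tilt[OF sub] face_tilt[OF sub f] order_trans[OF le mp]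
        order_trans[OF le_funD[OF le, of "- g"] mg]
      by (simp add: A_def)
    then have "tilt m h = m" using le by (rule min)
    then have "m (- h) \<le> - m h"
      using tilt_le[OF sub, of 1 h "- h"] sublinear_zero[OF sub] by simp
    then show ?thesis using sublinear_minus_ge[OF sub, of "- h"] by simp
  qed
  have lin: "linear m"
  proof (rule linearI)
    fix x y
    show "m (x + y) = m x + m y"
      using sublinear_add[OF sub, of x y] sublinear_add[OF sub, of "- x" "- y"]
        neg[of x] neg[of y] neg[of "x + y"] by simp
  next
    fix c :: real and x
    show "m (c *\<^sub>R x) = c *\<^sub>R m x"
    proof (cases "0 \<le> c")
      case True then show ?thesis using sublinear_scale[OF sub] by simp
    next
      case False
      then show ?thesis
        using sublinear_scale[OF sub, of "- c" x] neg[of "c *\<^sub>R x"] by simp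
    qed
  qed
  show thesis
  proof
    show "linear m" "m \<le> p" by (fact lin, fact mp)
    show "m g = p g" using mg neg[of g] mp by (auto simp: le_fun_def antisym)
    have "L1 = m" if L: "linear L1" "linear L2" "L1 \<le> p" "L2 \<le> p" "0 < t" "t < 1"
      "\<forall>x. m x = t * L1 x + (1 - t) * L2 x" for L1 L2 :: "'v \<Rightarrow> real" and t
    proof -
      \<comment> \<open>One linear functional below another equals it: compare the values at
        \<open>x\<close> and at \<open>- x\<close>.\<close>
      have "L1 \<le> m" using f[unfolded face_def, rule_format, of L1 L2 t] L by simp
      then have "L1 x \<le> m x" "L1 (- x) \<le> m (- x)" for x by (auto simp: le_fun_def)
      then show "L1 = m" using neg by (simp add: linear_neg[OF L(1)] fun_eq_iff antisym)
    qed
    then show "\<forall>L1 L2 t. linear L1 \<and> linear L2 \<and> L1 \<le> p \<and> L2 \<le> p \<and> 0 < t \<and> t < 1 \<and>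
       (\<forall>x. m x = t * L1 x + (1 - t) * L2 x) \<longrightarrow> L1 = m" by blast
  qed
qed

section \<open>Riesz representation on a compact metric space\<close>

lemma clamp_sum:
  fixes y :: real
  assumes "0 \<le> y"
  shows "(\<Sum>k<n. max 0 (min 1 (y - real k))) = min y (real n)"
  using assms by (induction n) (auto simp: min_def max_def)

locale normalized_positive_functional =
  fixes L :: "('a::metric_space \<Rightarrow> real) \<Rightarrow> real"
  assumes compact_UNIV: "compact (UNIV :: 'a set)"
    and L_add: "continuous_on UNIV f \<Longrightarrow> continuous_on UNIV g \<Longrightarrow> L (\<lambda>x. f x + g x) = L f + L g"
    and L_scale: "continuous_on UNIV f \<Longrightarrow> L (\<lambda>x. c * f x) = c * L f"
    and L_nonneg: "continuous_on UNIV f \<Longrightarrow> (\<And>x. 0 \<le> f x) \<Longrightarrow> 0 \<le> L f"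
    and L_one: "L (\<lambda>_. 1) = 1"
begin

lemma L_zero: "L (\<lambda>_. 0) = 0"
  using L_scale[of "\<lambda>_. 1" 0] by simp

lemma L_const: "L (\<lambda>_. c) = c"
  using L_scale[of "\<lambda>_. 1" c] L_one by simp

lemma L_diff:
  assumes "continuous_on UNIV f" "continuous_on UNIV g"
  shows "L (\<lambda>x. f x - g x) = L f - L g"
  using L_add[of f "\<lambda>x. - 1 * g x"] L_scale[of g "- 1"] assms
  by (simp add: continuous_on_minus)

lemma L_mono:
  assumes "continuous_on UNIV f" "continuous_on UNIV g" "\<And>x. f x \<le> g x"
  shows "L f \<le> L g"
  using L_nonneg[of "\<lambda>x. g x - f x"] assms by (simp add: L_diff continuous_on_diff)

lemma L_sum:
  assumes "\<And>i. i \<in> I \<Longrightarrow> continuous_on UNIV (f i)"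
  shows "L (\<lambda>x. \<Sum>i\<in>I. f i x) = (\<Sum>i\<in>I. L (f i))"
  using assms
  by (induction I rule: infinite_finite_induct)
    (simp_all add: L_zero L_add continuous_on_sum)

section \<open>The Daniell outer measure of a positive functional\<close>

definition cover :: "(nat \<Rightarrow> 'a \<Rightarrow> real) \<Rightarrow> 'a set \<Rightarrow> bool" where
  "cover h A \<longleftrightarrow> (\<forall>i. continuous_on UNIV (h i)) \<and> (\<forall>i x. 0 \<le> h i x) \<and>
     (\<forall>x\<in>A. 1 \<le> (\<Sum>i. ennreal (h i x)))"

text \<open>Sets are covered by series of nonnegative continuous functions, on which
  \<open>L\<close> can be evaluated at once, rather than by open sets.\<close>

definition outer :: "'a set \<Rightarrow> ennreal" where
  "outer A = (INF h\<in>{h. cover h A}. \<Sum>i. ennreal (L (h i)))"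

lemma outer_le: "cover h A \<Longrightarrow> outer A \<le> (\<Sum>i. ennreal (L (h i)))"
  unfolding outer_def by (rule INF_lower) simp

lemma outer_le_single:
  assumes f: "continuous_on UNIV f" "\<And>x. 0 \<le> f x" "\<And>x. x \<in> A \<Longrightarrow> 1 \<le> f x"
  shows "outer A \<le> ennreal (L f)"
proof -
  define h where "h i = (if i = 0 then f else (\<lambda>_. 0))" for i :: nat
  have *: "(\<Sum>i. ennreal (F (h i))) = ennreal (F f)" if "F (\<lambda>_. 0) = 0" for F
    using suminf_finite[of "{0}" "\<lambda>i. ennreal (F (h i))"] that by (simp add: h_def)
  have "cover h A"
    unfolding cover_def
  proof (intro conjI allI ballI)
    show "continuous_on UNIV (h i)" "0 \<le> h i x" for i x
      using f by (auto simp: h_def)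
    show "1 \<le> (\<Sum>i. ennreal (h i x))" if "x \<in> A" for x
      using *[of "\<lambda>g. g x"] f(3)[OF that] by (simp add: ennreal_ge_1)
  qed
  then show ?thesis using outer_le[of h A] *[of L] L_zero by simp
qed

lemma outer_empty: "outer {} = 0"
  using outer_le_single[of "\<lambda>_. 0" "{}"] by (simp add: L_zero)

lemma outer_mono: "A \<subseteq> B \<Longrightarrow> outer A \<le> outer B"
  unfolding outer_def by (rule INF_superset_mono) (auto simp: cover_def)

lemma outer_UN_le: "outer (\<Union>n. A n) \<le> (\<Sum>n. outer (A n))" for A :: "nat \<Rightarrow> 'a set"
proof (rule ennreal_le_epsilon)
  fix e :: real
  assume e: "0 < e" and fin: "(\<Sum>n. outer (A n)) < top"
  have "\<exists>h. cover h (A n) \<and> (\<Sum>i. ennreal (L (h i))) < outer (A n) + e * (1/2) ^ Suc n" for n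
  proof -
    \<comment> \<open>Strict because the finite total makes every \<open>outer (A n)\<close>
      finite.\<close>
    have "outer (A n) < outer (A n) + e * (1/2) ^ Suc n"
      using e ennreal_suminf_lessD[OF fin, of n] by auto
    then show ?thesis unfolding outer_def INF_less_iff by auto
  qed
  then obtain H where H: "\<And>n. cover (H n) (A n)"
    and less: "\<And>n. (\<Sum>i. ennreal (L (H n i))) < outer (A n) + e * (1/2) ^ Suc n"
    by metis
  define h where "h = case_prod H \<circ> prod_decode"
  have dbl: "(\<Sum>i. ennreal (F (h i))) = (\<Sum>n. \<Sum>i. ennreal (F (H n i)))" for F
    using suminf_ennreal_2dimen[of "\<lambda>n. \<Sum>i. ennreal (F (H n i))" "\<lambda>(n, i). ennreal (F (H n i))"]
    by (simp add: h_def split_def comp_def)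
  have "cover h (\<Union>n. A n)"
    unfolding cover_def
  proof (intro conjI allI ballI)
    fix i x
    show "continuous_on UNIV (h i)" "0 \<le> h i x"
      using H by (auto simp: h_def cover_def split_def)
  next
    fix x assume "x \<in> (\<Union>n. A n)"
    then obtain n where "x \<in> A n" by blast
    then have "1 \<le> (\<Sum>i. ennreal (H n i x))" using H by (auto simp: cover_def)
    also have "\<dots> \<le> (\<Sum>n. \<Sum>i. ennreal (H n i x))"
      using sum_le_suminf[of "\<lambda>n. \<Sum>i. ennreal (H n i x)" "{n}"] by simp
    finally show "1 \<le> (\<Sum>i. ennreal (h i x))" using dbl[of "\<lambda>g. g x"] by simp
  qed
  then have "outer (\<Union>n. A n) \<le> (\<Sum>n. \<Sum>i. ennreal (L (H n i)))"
    using outer_le dbl by metis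
  also have "\<dots> \<le> (\<Sum>n. outer (A n) + ennreal (e * (1/2) ^ Suc n))"
    using less by (intro suminf_le less_imp_le) auto
  also have "\<dots> = (\<Sum>n. outer (A n)) + (\<Sum>n. ennreal (e * (1/2) ^ Suc n))"
    by (rule suminf_add[symmetric]) auto
  also have "(\<Sum>n. ennreal (e * (1/2) ^ Suc n)) = ennreal e"
    using e sums_mult[OF power_half_series, of e] by (intro suminf_ennreal_eq) auto
  finally show "outer (\<Union>n. A n) \<le> (\<Sum>n. outer (A n)) + e" .
qed

lemma outer_Un_le: "outer (A \<union> B) \<le> outer A + outer B"
proof -
  have "outer (\<Union>n. binaryset A B n) \<le> (\<Sum>n. outer (binaryset A B n))"
    by (rule outer_UN_le)
  then show ?thesis
    using suminf_binaryset_eq[of outer A B] outer_empty UN_binaryset_eq[of A B] by simp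
qed

text \<open>Dini's argument: by compactness finitely many terms of a cover already reach \<open>1 - e\<close>.\<close>

lemma outer_UNIV: "outer UNIV = 1"
proof (rule antisym)
  show "outer UNIV \<le> 1"
    using outer_le_single[of "\<lambda>_. 1" UNIV] by (simp add: L_one)
  show "1 \<le> outer UNIV"
    unfolding outer_def
  proof (rule INF_greatest)
    fix h assume "h \<in> {h. cover h UNIV}"
    then have c: "\<And>i. continuous_on UNIV (h i)" and pos: "\<And>i x. 0 \<le> h i x"
      and ge: "\<And>x. 1 \<le> (\<Sum>i. ennreal (h i x))"
      by (auto simp: cover_def)
    have "1 - e \<le> (\<Sum>i. ennreal (L (h i)))" if e: "0 < e" for e :: real
    proof -
      define U where "U n = {x. 1 - e < (\<Sum>i<n. h i x)}" for n
      have "open (U n)" for n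
        unfolding U_def by (intro open_Collect_less continuous_intros c)
      moreover have "UNIV \<subseteq> (\<Union>n. U n)"
      proof
        fix x
        have "ennreal (1 - e) < 1" using e by (simp add: ennreal_less_one_iff)
        also have "\<dots> \<le> (SUP n. \<Sum>i<n. ennreal (h i x))"
          using ge by (simp add: suminf_eq_SUP)
        finally obtain n where "ennreal (1 - e) < (\<Sum>i<n. ennreal (h i x))"
          unfolding less_SUP_iff by auto
        then have "ennreal (1 - e) < ennreal (\<Sum>i<n. h i x)" using pos by (simp add: sum_ennreal)
        then have "1 - e < (\<Sum>i<n. h i x)" by (meson ennreal_leI not_le)
        then show "x \<in> (\<Union>n. U n)" by (auto simp: U_def)
      qed
      ultimately obtain D where D: "finite D" "UNIV \<subseteq> (\<Union>n\<in>D. U n)"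
        by (metis compactE_image[OF compact_UNIV])
      \<comment> \<open>Partial sums of nonnegative terms increase, so the largest index of the
        finite subcover works at every point; the inserted 0 keeps \<open>Max\<close> away from the
        empty set.\<close>
      define m where "m = Max (insert 0 D)"
      have le: "1 - e \<le> (\<Sum>i<m. h i x)" for x
      proof -
        obtain n where n: "n \<in> D" "x \<in> U n" using D by blast
        then have "(\<Sum>i<n. h i x) \<le> (\<Sum>i<m. h i x)"
          using D pos by (intro sum_mono2) (auto simp: m_def)
        then show ?thesis using n by (simp add: U_def)
      qed
      have "1 - e = L (\<lambda>_. 1 - e)" by (simp add: L_const)
      also have "\<dots> \<le> L (\<lambda>x. \<Sum>i<m. h i x)"
        using le by (intro L_mono continuous_intros c)
      also have "\<dots> = (\<Sum>i<m. L (h i))" by (intro L_sum c)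
      finally have "ennreal (1 - e) \<le> (\<Sum>i<m. ennreal (L (h i)))"
        using L_nonneg[OF c pos] by (simp add: ennreal_leI)
      also have "\<dots> \<le> (\<Sum>i. ennreal (L (h i)))" by (intro sum_le_suminf) auto
      finally show ?thesis .
    qed
    note * = this
    show "1 \<le> (\<Sum>i. ennreal (L (h i)))"
    proof (rule ennreal_le_epsilon)
      fix e :: real assume e: "0 < e"
      have "1 \<le> ennreal (1 - e) + ennreal e"
        using e by (cases "e \<le> 1")
          (auto simp: ennreal_plus[symmetric] ennreal_neg ennreal_ge_1 simp del: ennreal_plus)
      also have "\<dots> \<le> (\<Sum>i. ennreal (L (h i))) + ennreal e"
        by (intro add_right_mono * e)
      finally show "1 \<le> (\<Sum>i. ennreal (L (h i))) + ennreal e" .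
    qed
  qed
qed


text \<open>The functions \<phi> increase to the indicator of \<open>U\<close>, and their values
  under \<open>L\<close> are monotone and bounded, hence Cauchy. The increments of \<phi> beyond a
  late index \<open>k\<close> therefore have small total value, and their doubles cover the part of
  \<open>U\<close> near its boundary. The witness is \<open>2 * k\<close>.\<close>

lemma outer_annulus_small:
  assumes U: "open U" "U \<noteq> UNIV" and e: "0 < e"
  shows "\<exists>j. outer {x\<in>U. real j * infdist x (- U) < 1} \<le> ennreal e"
proof -
  define \<phi> where "\<phi> j x = min 1 (real j * infdist x (- U))" for j x
  have cont: "continuous_on UNIV (\<phi> j)" for j
    unfolding \<phi>_def by (intro continuous_intros)
  have mono: "\<phi> i x \<le> \<phi> j x" if "i \<le> j" for i j x
    unfolding \<phi>_def using that by (intro min.mono mult_right_mono infdist_nonneg) auto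
  have "convergent (\<lambda>i. L (\<phi> i))"
  proof (rule Bseq_monoseq_convergent)
    show "monoseq (\<lambda>i. L (\<phi> i))"
      by (intro monoI1 allI impI L_mono cont mono)
    have "0 \<le> L (\<phi> i)" "L (\<phi> i) \<le> 1" for i
    proof -
      show "0 \<le> L (\<phi> i)" by (intro L_nonneg cont) (simp add: \<phi>_def infdist_nonneg)
      have "L (\<phi> i) \<le> L (\<lambda>_. 1)" by (intro L_mono cont) (auto simp: \<phi>_def)
      then show "L (\<phi> i) \<le> 1" by (simp add: L_one)
    qed
    then show "Bseq (\<lambda>i. L (\<phi> i))" by (intro BseqI'[of _ 1]) auto
  qed
  then have "Cauchy (\<lambda>i. L (\<phi> i))" by (simp add: Cauchy_convergent_iff)
  then obtain k where k: "\<And>m n. m \<ge> k \<Longrightarrow> n \<ge> k \<Longrightarrow> dist (L (\<phi> m)) (L (\<phi> n)) < e / 2"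
    using e unfolding Cauchy_def by (meson half_gt_zero)
  \<comment> \<open>On the set to be covered \<open>\<phi> k\<close> is below 1/2, so the increments
    from \<open>k\<close> on sum to more than 1/2; the factor 2 lifts this to 1, and pays for the
    bound \<open>e / 2\<close> in the Cauchy condition.\<close>
  define h where "h i x = 2 * (\<phi> (k + Suc i) x - \<phi> (k + i) x)" for i x
  have nonneg: "0 \<le> h i x" for i x by (simp add: h_def mono)
  have conth: "continuous_on UNIV (h i)" for i
    unfolding h_def by (intro continuous_intros cont)
  have "cover h {x\<in>U. real (2 * k) * infdist x (- U) < 1}"
    unfolding cover_def
  proof (intro conjI allI ballI conth nonneg)
    fix x assume "x \<in> {x \<in> U. real (2 * k) * infdist x (- U) < 1}"
    then have x: "x \<in> U" "real k * infdist x (- U) < 1 / 2" by auto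
    have d: "0 < infdist x (- U)"
      using x U by (intro infdist_pos_not_in_closed) (auto simp: closed_def)
    then obtain n where n: "1 < real n * infdist x (- U)" using reals_Archimedean3 by blast
    have "\<phi> m x = 1" if "m \<ge> n" for m
    proof -
      have "real n * infdist x (- U) \<le> real m * infdist x (- U)"
        using that d by (intro mult_right_mono) auto
      then show ?thesis using n by (simp add: \<phi>_def)
    qed
    then have "(\<lambda>i. \<phi> (k + i) x) \<longlonglongrightarrow> 1"
      by (intro tendsto_eventually eventually_sequentiallyI[of n]) auto
    from telescope_sums[OF this] have "(\<lambda>i. \<phi> (k + Suc i) x - \<phi> (k + i) x) sums (1 - \<phi> k x)"
      by simp
    from sums_mult[OF this, of 2] have "(\<lambda>i. h i x) sums (2 * (1 - \<phi> k x))"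
      by (simp add: h_def)
    then have "(\<Sum>i. ennreal (h i x)) = ennreal (2 * (1 - \<phi> k x))"
      using nonneg by (intro suminf_ennreal_eq)
    moreover have "1 \<le> 2 * (1 - \<phi> k x)" using x by (simp add: \<phi>_def min_def)
    ultimately show "1 \<le> (\<Sum>i. ennreal (h i x))" by (simp add: ennreal_ge_1)
  qed
  then have "outer {x\<in>U. real (2 * k) * infdist x (- U) < 1} \<le> (\<Sum>i. ennreal (L (h i)))"
    by (rule outer_le)
  also have "\<dots> = (SUP n. \<Sum>i<n. ennreal (L (h i)))" by (rule suminf_eq_SUP)
  also have "\<dots> \<le> ennreal e"
  proof (rule SUP_least)
    fix n
    have Lh: "L (h i) = 2 * (L (\<phi> (k + Suc i)) - L (\<phi> (k + i)))" for i
      unfolding h_def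
      by (subst L_scale) (auto intro!: continuous_intros cont simp: L_diff[OF cont cont])
    have "(\<Sum>i<n. L (h i)) = 2 * (\<Sum>i<n. L (\<phi> (k + Suc i)) - L (\<phi> (k + i)))"
      by (simp add: Lh sum_distrib_left)
    also have "\<dots> = 2 * (L (\<phi> (k + n)) - L (\<phi> k))"
      using sum_lessThan_telescope[of "\<lambda>i. L (\<phi> (k + i))" n] by simp
    also have "\<dots> \<le> e"
    proof -
      have "dist (L (\<phi> (k + n))) (L (\<phi> k)) < e / 2" by (intro k) auto
      then have "L (\<phi> (k + n)) - L (\<phi> k) < e / 2"
        unfolding dist_real_def by (rule le_less_trans[OF abs_ge_self])
      then show ?thesis by simp
    qed
    finally have "(\<Sum>i<n. L (h i)) \<le> e" .
    then show "(\<Sum>i<n. ennreal (L (h i))) \<le> ennreal e"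
      using L_nonneg[OF conth nonneg] by (simp add: sum_ennreal ennreal_leI)
  qed
  finally show ?thesis by blast
qed

text \<open>Caratheodory's criterion for open sets. A continuous \<phi> that vanishes off
  \<open>U\<close> splits each cover \<open>h\<close> of \<open>A\<close> into
  \<open>h * \<phi>\<close>, which covers the points with \<phi> = 1, and
  \<open>h * (1 - \<phi>)\<close>, which covers \<open>A - U\<close>. What is left of
  \<open>A \<inter> U\<close> lies near the boundary and costs at most \<open>e\<close>.\<close>

lemma outer_split_open:
  assumes U: "open U"
  shows "outer (A \<inter> U) + outer (A - U) = outer A"
proof (rule antisym)
  show "outer A \<le> outer (A \<inter> U) + outer (A - U)"
    using outer_Un_le[of "A \<inter> U" "A - U"] by (simp add: Int_Diff_Un)
  show "outer (A \<inter> U) + outer (A - U) \<le> outer A"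
  proof (cases "U = UNIV")
    case True then show ?thesis by (simp add: outer_empty)
  next
    case False
    show ?thesis
    proof (rule ennreal_le_epsilon)
      fix e :: real assume e: "0 < e"
      obtain j where j: "outer {x\<in>U. real j * infdist x (- U) < 1} \<le> ennreal e"
        using outer_annulus_small[OF U False e] by blast
      define \<phi> where "\<phi> x = min 1 (real j * infdist x (- U))" for x
      have cont: "continuous_on UNIV \<phi>"
        unfolding \<phi>_def by (intro continuous_intros)
      have \<phi>: "0 \<le> \<phi> x" "\<phi> x \<le> 1" for x by (auto simp: \<phi>_def infdist_nonneg)
      have le: "outer {x\<in>A. \<phi> x = 1} + outer (A - U) \<le> outer A"
        unfolding outer_def[of A]
      proof (rule INF_greatest)
        fix h assume "h \<in> {h. cover h A}"
        then have c: "\<And>i. continuous_on UNIV (h i)" and pos: "\<And>i x. 0 \<le> h i x"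
          and ge: "\<And>x. x \<in> A \<Longrightarrow> 1 \<le> (\<Sum>i. ennreal (h i x))"
          by (auto simp: cover_def)
        have "\<phi> x = 0" if "x \<notin> U" for x using that by (simp add: \<phi>_def)
        then have c1: "cover (\<lambda>i x. h i x * \<phi> x) {x\<in>A. \<phi> x = 1}"
          and c2: "cover (\<lambda>i x. h i x * (1 - \<phi> x)) (A - U)"
          using c pos ge \<phi> by (auto simp: cover_def intro!: continuous_intros cont)
        have eq: "ennreal (L (\<lambda>x. h i x * \<phi> x)) + ennreal (L (\<lambda>x. h i x * (1 - \<phi> x)))
            = ennreal (L (h i))" for i
        proof -
          have "L (\<lambda>x. h i x * \<phi> x + h i x * (1 - \<phi> x))
              = L (\<lambda>x. h i x * \<phi> x) + L (\<lambda>x. h i x * (1 - \<phi> x))"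
            by (intro L_add continuous_intros c cont)
          moreover have "(\<lambda>x. h i x * \<phi> x + h i x * (1 - \<phi> x)) = h i"
            by (auto simp: algebra_simps)
          moreover have "0 \<le> L (\<lambda>x. h i x * \<phi> x)" "0 \<le> L (\<lambda>x. h i x * (1 - \<phi> x))"
            using pos \<phi> by (auto intro!: L_nonneg continuous_intros c cont)
          ultimately show ?thesis by (simp add: ennreal_plus[symmetric] del: ennreal_plus)
        qed
        have "outer {x\<in>A. \<phi> x = 1} + outer (A - U)
            \<le> (\<Sum>i. ennreal (L (\<lambda>x. h i x * \<phi> x))) + (\<Sum>i. ennreal (L (\<lambda>x. h i x * (1 - \<phi> x))))"
          by (intro add_mono outer_le c1 c2)
        also have "\<dots> = (\<Sum>i. ennreal (L (h i)))"
          by (subst suminf_add) (auto simp: eq)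
        finally show "outer {x\<in>A. \<phi> x = 1} + outer (A - U) \<le> (\<Sum>i. ennreal (L (h i)))" .
      qed
      have "outer (A \<inter> U) \<le> outer {x\<in>A. \<phi> x = 1} + ennreal e"
      proof -
        have "A \<inter> U \<subseteq> {x\<in>A. \<phi> x = 1} \<union> {x\<in>U. real j * infdist x (- U) < 1}"
          by (auto simp: \<phi>_def)
        then have "outer (A \<inter> U) \<le> outer ({x\<in>A. \<phi> x = 1} \<union> {x\<in>U. real j * infdist x (- U) < 1})"
          by (rule outer_mono)
        also have "\<dots> \<le> outer {x\<in>A. \<phi> x = 1} + outer {x\<in>U. real j * infdist x (- U) < 1}"
          by (rule outer_Un_le)
        also have "\<dots> \<le> outer {x\<in>A. \<phi> x = 1} + ennreal e" using j by (rule add_left_mono)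
        finally show ?thesis .
      qed
      then have "outer (A \<inter> U) + outer (A - U)
          \<le> (outer {x\<in>A. \<phi> x = 1} + ennreal e) + outer (A - U)"
        by (rule add_right_mono)
      also have "\<dots> = (outer {x\<in>A. \<phi> x = 1} + outer (A - U)) + ennreal e"
        by (simp only: ac_simps)
      also have "\<dots> \<le> outer A + ennreal e"
        using le by (rule add_right_mono)
      finally show "outer (A \<inter> U) + outer (A - U) \<le> outer A + ennreal e" .
    qed
  qed
qed

section \<open>Caratheodory extension to the Borel sets\<close>

definition rep_measure :: "'a measure" where
  "rep_measure = measure_of UNIV (sets borel) outer"

lemma sets_rep_measure [simp]: "sets rep_measure = sets borel"
  by (simp add: rep_measure_def sets.sigma_sets_eq[of borel, simplified])

lemma space_rep_measure [simp]: "space rep_measure = UNIV"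
  by (simp add: rep_measure_def)

lemma emeasure_rep_measure:
  assumes A: "A \<in> sets borel"
  shows "emeasure rep_measure A = outer A"
proof -
  interpret P: sigma_algebra UNIV "Pow UNIV :: 'a set set" by (rule sigma_algebra_Pow)
  have "outer_measure_space (Pow UNIV) outer"
    unfolding outer_measure_space_def positive_def increasing_def countably_subadditive_def
    by (auto simp: outer_empty outer_mono outer_UN_le)
  then have ms: "measure_space UNIV (lambda_system UNIV (Pow UNIV) outer) outer"
    by (rule P.caratheodory_lemma)
  then interpret S: sigma_algebra UNIV "lambda_system UNIV (Pow UNIV) outer"
    by (simp add: measure_space_def)
  have "{U. open U} \<subseteq> lambda_system UNIV (Pow UNIV) outer"
    unfolding P.lambda_system_eq by (auto simp: outer_split_open)
  then have "sigma_sets UNIV {U. open U} \<subseteq> lambda_system UNIV (Pow UNIV) outer"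
    by (rule S.sigma_sets_subset)
  then have sub: "sets borel \<subseteq> lambda_system UNIV (Pow UNIV) outer"
    unfolding borel_def by (simp only: sets_measure_of Pow_UNIV subset_UNIV)
  have "countably_additive (lambda_system UNIV (Pow UNIV) outer) outer"
    using ms by (simp add: measure_space_def)
  then have "countably_additive (sets borel) outer"
    using sub unfolding countably_additive_def by (meson subset_trans subsetD)
  then have ca: "countably_additive (sets rep_measure) outer" by simp
  show ?thesis
    by (rule emeasure_measure_of[OF rep_measure_def _ _ ca])
      (auto simp: A positive_def outer_empty)
qed

lemma prob_space_rep_measure: "prob_space rep_measure"
  by (rule prob_spaceI) (simp add: emeasure_rep_measure outer_UNIV)


section \<open>Integrals against the representing measure\<close>

lemma bounded_continuous:
  fixes f :: "'a \<Rightarrow> real"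
  assumes "continuous_on UNIV f"
  obtains B where "0 < B" "\<And>x. \<bar>f x\<bar> \<le> B"
proof -
  have "bounded (range f)"
    by (rule compact_imp_bounded[OF compact_continuous_image[OF assms compact_UNIV]])
  then show thesis using that by (auto simp: bounded_pos)
qed

lemma integrable_rep_measure:
  fixes f :: "'a \<Rightarrow> real"
  assumes "continuous_on UNIV f"
  shows "integrable rep_measure f"
proof -
  interpret prob_space rep_measure by (rule prob_space_rep_measure)
  have "f \<in> borel_measurable rep_measure"
    using borel_measurable_continuous_onI[OF assms]
    by (subst measurable_cong_sets[of _ borel _ borel]) auto
  moreover obtain B where "\<And>x. \<bar>f x\<bar> \<le> B" using bounded_continuous[OF assms] by blast
  ultimately show ?thesis by (intro integrable_const_bound[of _ B]) auto
qed

text \<open>Writing \<open>n f\<close> as the sum of its layers \<open>\<psi> k = max 0 (min 1 (n f - k))\<close>, each layer lies below the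
  indicator of \<open>n f > k\<close>, where the preceding layer is \<open>1\<close>.\<close>

lemma integral_rep_measure_le_unit:
  assumes f: "continuous_on UNIV f" "\<And>x. 0 \<le> f x" "\<And>x. f x \<le> 1"
  shows "(LINT x|rep_measure. f x) \<le> L f"
proof (rule field_le_epsilon)
  interpret prob_space rep_measure by (rule prob_space_rep_measure)
  fix e :: real assume "0 < e"
  then obtain n :: nat where n: "n \<noteq> 0" "1 / real n < e"
    using nat_approx_posE by (metis nat.distinct(1) of_nat_Suc)
  define \<psi> where "\<psi> k x = max 0 (min 1 (real n * f x - real k))" for k x
  have cont: "continuous_on UNIV (\<psi> k)" for k
    unfolding \<psi>_def by (intro continuous_intros f)
  have pos: "0 \<le> \<psi> k x" for k x by (simp add: \<psi>_def)
  have le1: "\<psi> k x \<le> 1" for k x by (simp add: \<psi>_def)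
  have sum: "(\<Sum>k<n. \<psi> k x) = real n * f x" for x
    using clamp_sum[of "real n * f x" n] f mult_left_mono[OF f(3)[of x], of "real n"]
    by (simp add: \<psi>_def min_def)
  have step: "(LINT x|rep_measure. \<psi> (Suc k) x) \<le> L (\<psi> k)" for k
  proof -
    let ?A = "{x. 0 < \<psi> (Suc k) x}"
    have "open ?A" by (intro open_Collect_less continuous_intros cont)
    then have A: "?A \<in> sets borel" by simp
    have "1 \<le> \<psi> k x" if "x \<in> ?A" for x
      using that by (auto simp: \<psi>_def max_def min_def split: if_splits)
    then have "emeasure rep_measure ?A \<le> ennreal (L (\<psi> k))"
      unfolding emeasure_rep_measure[OF A] by (intro outer_le_single cont pos)
    then have "measure rep_measure ?A \<le> L (\<psi> k)"
      using L_nonneg[OF cont pos] by (simp add: emeasure_eq_measure)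
    moreover have "(LINT x|rep_measure. \<psi> (Suc k) x) \<le> (LINT x|rep_measure. indicator ?A x)"
    proof (intro integral_mono integrable_rep_measure[OF cont])
      show "integrable rep_measure (indicator ?A :: 'a \<Rightarrow> real)"
        using A by (intro integrable_real_indicator) (auto simp: emeasure_eq_measure)
      show "\<psi> (Suc k) x \<le> indicator ?A x" for x
        using pos le1 by (auto simp: indicator_def not_less)
    qed
    ultimately show ?thesis using A by simp
  qed
  have "real n * (LINT x|rep_measure. f x) = (LINT x|rep_measure. (\<Sum>k<n. \<psi> k x))"
    by (simp add: sum)
  also have "\<dots> = (\<Sum>k<n. LINT x|rep_measure. \<psi> k x)"
    by (intro Bochner_Integration.integral_sum integrable_rep_measure cont)
  \<comment> \<open>One more layer is added so that layer 0 can be split off and \<open>step\<close>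
    applied to all the others. Layer 0 costs at most 1, which becomes \<open>1 / n\<close> after
    division.\<close>
  also have "\<dots> \<le> (\<Sum>k<Suc n. LINT x|rep_measure. \<psi> k x)"
    using pos by (intro sum_mono2) (auto intro: integral_nonneg_AE)
  also have "\<dots> = (LINT x|rep_measure. \<psi> 0 x) + (\<Sum>k<n. LINT x|rep_measure. \<psi> (Suc k) x)"
    by (rule sum.lessThan_Suc_shift)
  also have "\<dots> \<le> 1 + (\<Sum>k<n. L (\<psi> k))"
  proof (intro add_mono sum_mono step)
    have "(LINT x|rep_measure. \<psi> 0 x) \<le> (LINT x|rep_measure. 1)"
      using le1 by (intro integral_mono integrable_rep_measure cont) auto
    then show "(LINT x|rep_measure. \<psi> 0 x) \<le> 1" by (simp add: prob_space[simplified])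
  qed
  also have "(\<Sum>k<n. L (\<psi> k)) = real n * L f"
    using L_sum[of "{..<n}" \<psi>] L_scale[OF f(1), of "real n"] cont by (simp add: sum)
  finally have "(LINT x|rep_measure. f x) \<le> 1 / real n + L f"
    using n by (simp add: field_simps)
  then show "(LINT x|rep_measure. f x) \<le> L f + e" using n by simp
qed

text \<open>An affine change brings a bounded function into the range from 0 to 1, where the
  inequality is known; the inequality for \<open>- f\<close> then gives equality.\<close>

lemma integral_rep_measure:
  assumes f: "continuous_on UNIV f"
  shows "(LINT x|rep_measure. f x) = L f"
proof -
  interpret prob_space rep_measure by (rule prob_space_rep_measure)
  have le: "(LINT x|rep_measure. g x) \<le> L g" if g: "continuous_on UNIV g" for g
  proof -
    obtain B where B: "0 < B" "\<And>x. \<bar>g x\<bar> \<le> B" using bounded_continuous[OF g] by blast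
    define h where "h x = 1 / (2 * B) * (g x + B)" for x
    have "continuous_on UNIV h" unfolding h_def by (intro continuous_intros g)
    moreover have "0 \<le> h x \<and> h x \<le> 1" for x
      using B(1) B(2)[of x] by (simp add: h_def field_simps abs_le_iff)
    ultimately have "(LINT x|rep_measure. h x) \<le> L h"
      by (intro integral_rep_measure_le_unit) auto
    also have "L h = 1 / (2 * B) * (L g + B)"
      unfolding h_def by (subst L_scale) (auto intro!: continuous_intros g simp: L_add g L_const)
    also have "(LINT x|rep_measure. h x) = 1 / (2 * B) * ((LINT x|rep_measure. g x) + B)"
      unfolding h_def using integrable_rep_measure[OF g] by (simp add: prob_space[simplified])
    finally show ?thesis using B(1) by (simp add: field_simps)
  qed
  have "(LINT x|rep_measure. - 1 * f x) \<le> L (\<lambda>x. - 1 * f x)"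
    by (intro le continuous_intros f)
  then have "- (LINT x|rep_measure. f x) \<le> - L f"
    using L_scale[OF f, of "- 1"] by simp
  then show ?thesis using le[OF f] by simp
qed

end

theorem riesz_representation_compact:
  fixes L :: "('a::metric_space \<Rightarrow> real) \<Rightarrow> real"
  assumes "normalized_positive_functional L"
  obtains Q where "sets Q = sets borel" "prob_space Q"
    "\<And>f. continuous_on UNIV f \<Longrightarrow> (LINT x|Q. f x) = L f"
proof -
  interpret normalized_positive_functional L by fact
  show thesis
    using that[OF sets_rep_measure prob_space_rep_measure integral_rep_measure] .
qed

section \<open>Ergodic measures maximizing an integral\<close>

text \<open>The indicator of an open set is a pointwise limit of continuous functions of the
  distance to its complement, and the open sets are an intersection-stable generator of the Borel
  sets.\<close>

lemma measure_eqI_continuous: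
  fixes M N :: "'a::metric_space measure"
  assumes M: "finite_measure M" "sets M = sets borel"
    and N: "finite_measure N" "sets N = sets borel"
    and eq: "\<And>f :: 'a \<Rightarrow> real. continuous_on UNIV f \<Longrightarrow> (\<And>x. 0 \<le> f x) \<Longrightarrow> (\<And>x. f x \<le> 1) \<Longrightarrow>
      (LINT x|M. f x) = (LINT x|N. f x)"
  shows "M = N"
proof (rule measure_eqI_generator_eq[of "{U. open U}" UNIV M N "\<lambda>_. UNIV"])
  show "emeasure M U = emeasure N U" if "U \<in> {U. open U}" for U
  proof -
    \<comment> \<open>The whole space is treated apart because \<open>infdist\<close> to the empty
      set is 0 by convention.\<close>
    define \<phi> :: "nat \<Rightarrow> 'a \<Rightarrow> real"
      where "\<phi> j x = (if U = UNIV then 1 else min 1 (real j * infdist x (- U)))" for j x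
    have cont: "continuous_on UNIV (\<phi> j)" for j
      unfolding \<phi>_def by (cases "U = UNIV") (auto intro!: continuous_intros)
    have bnd: "0 \<le> \<phi> j x" "\<phi> j x \<le> 1" for j x by (auto simp: \<phi>_def infdist_nonneg)
    have lim: "(\<lambda>j. \<phi> j x) \<longlonglongrightarrow> indicator U x" for x
    proof (cases "x \<in> U \<and> U \<noteq> UNIV")
      case True
      then have d: "0 < infdist x (- U)"
        using that by (intro infdist_pos_not_in_closed) (auto simp: closed_def)
      then obtain n where n: "1 < real n * infdist x (- U)" using reals_Archimedean3 by blast
      have "\<phi> m x = 1" if "m \<ge> n" for m
      proof -
        have "real n * infdist x (- U) \<le> real m * infdist x (- U)"
          using that d by (intro mult_right_mono) auto
        then show ?thesis using n by (simp add: \<phi>_def)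
      qed
      then show ?thesis
        using True by (intro tendsto_eventually eventually_sequentiallyI[of n]) auto
    next
      case False
      then have "\<phi> j x = indicator U x" for j by (auto simp: \<phi>_def)
      then show ?thesis by simp
    qed
    have tends: "(\<lambda>j. LINT x|K. \<phi> j x) \<longlonglongrightarrow> measure K U"
      if K: "finite_measure K" "sets K = sets borel" for K
    proof -
      interpret finite_measure K by fact
      have [measurable]: "U \<in> sets borel" using \<open>U \<in> {U. open U}\<close> by simp
      have "(\<lambda>j. LINT x|K. \<phi> j x) \<longlonglongrightarrow> (LINT x|K. indicator U x)"
      proof (rule integral_dominated_convergence[where w = "\<lambda>_. 1"])
        show "(indicator U :: 'a \<Rightarrow> real) \<in> borel_measurable K"
          by (subst measurable_cong_sets[OF K(2) refl]) measurable
        show "\<phi> j \<in> borel_measurable K" for j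
          using borel_measurable_continuous_onI[OF cont]
          by (subst measurable_cong_sets[OF K(2) refl])
      qed (use lim bnd in auto)
      then show ?thesis by (simp add: K(2) sets_eq_imp_space_eq[OF K(2)])
    qed
    have "measure M U = measure N U"
      using LIMSEQ_unique[OF tends[OF M]] tends[OF N] eq[OF cont bnd] by simp
    then show ?thesis
      using M(1) N(1) by (simp add: finite_measure.emeasure_eq_measure)
  qed
  show "emeasure M UNIV \<noteq> \<infinity>"
    using finite_measure.emeasure_finite[OF M(1)] by simp
qed (auto simp: M N borel_def Int_stable_def)

text \<open>The type of bounded continuous functions provides the real vector space on which
  \<open>extreme_dominated_functional\<close> is used; compactness puts every continuous function
  into it.\<close>

lemma apply_bcontfun_Bcontfun:
  fixes f :: "'a::metric_space \<Rightarrow> real"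
  assumes "compact (UNIV :: 'a set)" "continuous_on UNIV f"
  shows "apply_bcontfun (Bcontfun f) = f"
proof -
  have "bounded (range f)"
    by (rule compact_imp_bounded[OF compact_continuous_image[OF assms(2,1)]])
  then show ?thesis using assms(2) by (intro Bcontfun_inverse) (simp add: bcontfun_def)
qed

text \<open>The value at \<open>g\<close> is the supremum of the integrals of \<open>g\<close> over all invariant measures, in dual form.
  An extreme functional dominated by it is represented by an ergodic measure.\<close>

definition coboundary_sup :: "('a::metric_space \<Rightarrow> 'a) \<Rightarrow> ('a \<Rightarrow>\<^sub>C real) \<Rightarrow> real" where
  "coboundary_sup S h = (INF u :: 'a \<Rightarrow>\<^sub>C real. SUP x. h x + u x - u (S x))"

context
  fixes S :: "'a::metric_space \<Rightarrow> 'a"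
  assumes comp: "compact (UNIV :: 'a set)" and S: "continuous_on UNIV S"
begin

lemma continuous_on_bcontfun_comp: "continuous_on UNIV (\<lambda>x. apply_bcontfun u (S x))"
  using continuous_on_compose2[OF continuous_on_apply_bcontfun[of UNIV u] S] by simp

lemma bdd_above_coboundary:
  fixes h u :: "'a \<Rightarrow>\<^sub>C real"
  shows "bdd_above (range (\<lambda>x. h x + u x - u (S x)))"
proof -
  have "continuous_on UNIV (\<lambda>x. h x + u x - u (S x))"
    by (intro continuous_intros continuous_on_bcontfun_comp) auto
  then have "bounded (range (\<lambda>x. h x + u x - u (S x)))"
    by (intro compact_imp_bounded compact_continuous_image comp)
  then show ?thesis by (rule bounded_imp_bdd_above)
qed

lemma coboundary_le_SUP:
  fixes h u :: "'a \<Rightarrow>\<^sub>C real"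
  shows "h y + u y - u (S y) \<le> (SUP x. h x + u x - u (S x))"
  by (rule cSUP_upper[OF _ bdd_above_coboundary]) simp

text \<open>At a maximum point of \<open>u\<close> the coboundary \<open>u y - u (S y)\<close> is
  nonnegative. This keeps the infimum in \<open>coboundary_sup\<close> finite.\<close>

lemma SUP_coboundary_ge:
  fixes h u :: "'a \<Rightarrow>\<^sub>C real"
  assumes "\<And>x. b \<le> h x"
  shows "b \<le> (SUP x. h x + u x - u (S x))"
proof -
  obtain y where "\<And>x. u x \<le> u y"
    using continuous_attains_sup[OF comp _ continuous_on_apply_bcontfun[of UNIV u]] by auto
  then have "b \<le> h y + u y - u (S y)" using assms[of y] by (smt (verit))
  then show ?thesis using coboundary_le_SUP[of h y u] by linarith
qed

lemma bdd_below_SUP_coboundary: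
  "bdd_below (range (\<lambda>u :: 'a \<Rightarrow>\<^sub>C real. SUP x. apply_bcontfun h x + u x - u (S x)))"
proof -
  have "bdd_below (range (apply_bcontfun h))"
    by (rule bounded_imp_bdd_below[OF bounded_apply_bcontfun])
  then obtain b where "\<And>x. b \<le> h x" by (auto simp: bdd_below_def)
  then show ?thesis by (intro bdd_belowI2 SUP_coboundary_ge)
qed

lemma coboundary_sup_le:
  assumes "\<And>x. apply_bcontfun h x + apply_bcontfun u x - apply_bcontfun u (S x) \<le> c"
  shows "coboundary_sup S h \<le> c"
proof -
  have "coboundary_sup S h \<le> (SUP x. h x + u x - u (S x))"
    unfolding coboundary_sup_def by (rule cINF_lower[OF bdd_below_SUP_coboundary]) simp
  also have "\<dots> \<le> c" using assms by (intro cSUP_least) auto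
  finally show ?thesis .
qed

lemma sublinear_coboundary_sup: "sublinear (coboundary_sup S)"
proof -
  have "sublinear (\<lambda>h. INF u::'a \<Rightarrow>\<^sub>C real. SUP x. apply_bcontfun h x + u x - u (S x))"
  proof (rule sublinear_INF[OF _ bdd_below_SUP_coboundary])
    fix u h :: "'a \<Rightarrow>\<^sub>C real" and c :: real assume c: "0 < c"
    have "(SUP x. (c *\<^sub>R h) x + (c *\<^sub>R u) x - (c *\<^sub>R u) (S x)) \<le> c * (SUP x. h x + u x - u (S x))"
    proof (rule cSUP_least)
      fix x
      have "c * (h x + u x - u (S x)) \<le> c * (SUP x. h x + u x - u (S x))"
        using c by (intro mult_left_mono coboundary_le_SUP) auto
      then show "(c *\<^sub>R h) x + (c *\<^sub>R u) x - (c *\<^sub>R u) (S x) \<le> c * (SUP x. h x + u x - u (S x))"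
        by (simp add: algebra_simps)
    qed simp
    then show "\<exists>v\<in>UNIV. (SUP x. (c *\<^sub>R h) x + apply_bcontfun v x - apply_bcontfun v (S x))
        \<le> c * (SUP x. h x + u x - u (S x))"
      by blast
  next
    fix u v h k :: "'a \<Rightarrow>\<^sub>C real"
    have "(SUP x. (h + k) x + (u + v) x - (u + v) (S x))
        \<le> (SUP x. h x + u x - u (S x)) + (SUP x. k x + v x - v (S x))"
    proof (rule cSUP_least)
      fix x
      show "(h + k) x + (u + v) x - (u + v) (S x)
          \<le> (SUP x. h x + u x - u (S x)) + (SUP x. k x + v x - v (S x))"
        using coboundary_le_SUP[of h x u] coboundary_le_SUP[of k x v] by simp
    qed simp
    then show "\<exists>w\<in>UNIV. (SUP x. (h + k) x + apply_bcontfun w x - apply_bcontfun w (S x))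
        \<le> (SUP x. h x + u x - u (S x)) + (SUP x. k x + v x - v (S x))"
      by blast
  next
    have "coboundary_sup S 0 \<le> 0" by (rule coboundary_sup_le[of _ 0]) simp
    moreover have "0 \<le> coboundary_sup S 0"
      unfolding coboundary_sup_def by (intro cINF_greatest SUP_coboundary_ge) auto
    ultimately show "(INF u::'a \<Rightarrow>\<^sub>C real. SUP x. apply_bcontfun 0 x + u x - u (S x)) = 0"
      by (simp add: coboundary_sup_def)
  qed simp
  then show ?thesis by (simp add: coboundary_sup_def[abs_def])
qed

text \<open>The form in which the dual value is used: summed along an orbit, the coboundary of
  \<open>u\<close> telescopes and leaves a bound on the sums of \<open>g\<close>.\<close>

lemma coboundary_sup_attained:
  fixes g :: "'a \<Rightarrow> real"
  assumes g: "continuous_on UNIV g" and e: "0 < e"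
  shows "\<exists>u. continuous_on UNIV u \<and> (\<forall>x. g x + u x - u (S x) \<le> coboundary_sup S (Bcontfun g) + e)"
proof -
  have "coboundary_sup S (Bcontfun g) < coboundary_sup S (Bcontfun g) + e" using e by simp
  then obtain u :: "'a \<Rightarrow>\<^sub>C real"
    where u: "(SUP x. Bcontfun g x + u x - u (S x)) < coboundary_sup S (Bcontfun g) + e"
    unfolding coboundary_sup_def cINF_less_iff[OF UNIV_not_empty bdd_below_SUP_coboundary] by auto
  have "g x + u x - u (S x) \<le> coboundary_sup S (Bcontfun g) + e" for x
    using coboundary_le_SUP[of "Bcontfun g" x u] u by (simp add: apply_bcontfun_Bcontfun[OF comp g])
  then show ?thesis using continuous_on_apply_bcontfun by blast
qed

text \<open>By invariance of \<open>Q\<close> and of \<open>B\<close>, coboundaries integrate to 0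
  over \<open>B\<close>. The general \<open>B\<close> makes the normalized restriction of
  \<open>Q\<close> to an invariant set a dominated functional too.\<close>

lemma invariant_integral_le_coboundary_sup:
  assumes Q: "invariant_prob S Q" and B: "B \<in> sets borel" "S -` B = B"
  shows "(LINT x|Q. indicator B x * apply_bcontfun h x) \<le> measure Q B * coboundary_sup S h"
proof -
  interpret prob_space Q using Q by (simp add: invariant_prob_def)
  have sQ: "sets Q = sets borel" and dQ: "distr Q borel S = Q"
    using Q by (auto simp: invariant_prob_def)
  have [measurable]: "S \<in> borel_measurable borel" by (rule borel_measurable_continuous_onI[OF S])
  note [measurable] = B(1)
  note [measurable_cong] = sQ
  have [measurable]: "apply_bcontfun u \<in> borel_measurable borel" for u :: "'a \<Rightarrow>\<^sub>C real"
    by (rule borel_measurable_continuous_onI) simp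
  have int: "integrable Q (\<lambda>x. indicator B x * u (R x))"
    if [measurable]: "R \<in> borel_measurable borel" for u :: "'a \<Rightarrow>\<^sub>C real" and R :: "'a \<Rightarrow> 'a"
  proof -
    obtain b where "0 < b" "\<And>x. \<bar>u x\<bar> \<le> b"
      using bounded_apply_bcontfun[of u] by (auto simp: bounded_pos)
    then show ?thesis
      by (intro integrable_const_bound[of _ b]) (auto simp: indicator_def)
  qed
  have inv: "(LINT x|Q. indicator B x * u (S x)) = (LINT x|Q. indicator B x * u x)"
    for u :: "'a \<Rightarrow>\<^sub>C real"
  proof -
    have "(LINT x|Q. indicator B x * u x) = (LINT x|distr Q borel S. indicator B x * u x)"
      by (simp add: dQ)
    also have "\<dots> = (LINT x|Q. indicator B (S x) * u (S x))"
      by (intro integral_distr) measurable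
    also have "\<dots> = (LINT x|Q. indicator B x * u (S x))"
      using B(2) by (intro Bochner_Integration.integral_cong) (auto simp: indicator_def)
    finally show ?thesis ..
  qed
  have le: "(LINT x|Q. indicator B x * h x) \<le> measure Q B * (SUP x. h x + u x - u (S x))"
    for u :: "'a \<Rightarrow>\<^sub>C real"
  proof -
    let ?s = "SUP x. h x + u x - u (S x)"
    have "(LINT x|Q. indicator B x * h x)
        = (LINT x|Q. indicator B x * h x + indicator B x * u x - indicator B x * u (S x))"
      using int[of "\<lambda>x. x" h] int[of "\<lambda>x. x" u] int[of S u] inv[of u] by simp
    also have "\<dots> \<le> (LINT x|Q. indicator B x * ?s)"
    proof (rule integral_mono)
      show "integrable Q (\<lambda>x. indicator B x * h x + indicator B x * u x - indicator B x * u (S x))"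
        using int[of "\<lambda>x. x" h] int[of "\<lambda>x. x" u] int[of S u] by auto
      show "integrable Q (\<lambda>x. indicator B x * ?s)"
        by (intro integrable_mult_left integrable_real_indicator) (auto simp: emeasure_eq_measure)
      show "indicator B x * h x + indicator B x * u x - indicator B x * u (S x) \<le> indicator B x * ?s"
        for x using coboundary_le_SUP[of h x u] by (auto simp: indicator_def)
    qed
    also have "\<dots> = measure Q B * ?s" by (simp add: sets_eq_imp_space_eq[OF sQ])
    finally show ?thesis .
  qed
  show ?thesis
  proof (cases "measure Q B = 0")
    case True then show ?thesis using le[of 0] by simp
  next
    case False
    then have pos: "0 < measure Q B" by (simp add: zero_less_measure_iff)
    have "(LINT x|Q. indicator B x * h x) / measure Q B \<le> coboundary_sup S h"
      unfolding coboundary_sup_def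
      using le pos by (intro cINF_greatest) (auto simp: field_simps)
    then show ?thesis using pos by (simp add: field_simps)
  qed
qed

text \<open>Domination encodes all that is required: \<open>u = 0\<close> gives positivity and total
  mass 1, while \<open>u = f\<close> and \<open>u = - f\<close> force \<open>f\<close> and its
  composition with \<open>S\<close> to have the same value.\<close>

lemma invariant_prob_of_functional:
  assumes L: "linear L" "L \<le> coboundary_sup S"
  obtains Q where "invariant_prob S Q" "\<And>h. (LINT x|Q. apply_bcontfun h x) = L h"
proof -
  have bc: "apply_bcontfun (Bcontfun f) = f" if "continuous_on UNIV f" for f :: "'a \<Rightarrow> real"
    by (rule apply_bcontfun_Bcontfun[OF comp that])
  have Lle: "L h \<le> c" if "\<And>x. apply_bcontfun h x + apply_bcontfun u x - apply_bcontfun u (S x) \<le> c"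
    for h u c
    using le_funD[OF L(2), of h] coboundary_sup_le[OF that] by (rule order_trans)
  have "normalized_positive_functional (\<lambda>f. L (Bcontfun f))"
  proof
    show "compact (UNIV :: 'a set)" by (rule comp)
  next
    fix f g :: "'a \<Rightarrow> real" assume fg: "continuous_on UNIV f" "continuous_on UNIV g"
    then have "Bcontfun (\<lambda>x. f x + g x) = Bcontfun f + Bcontfun g"
      by (intro bcontfun_eqI) (simp add: bc continuous_on_add)
    then show "L (Bcontfun (\<lambda>x. f x + g x)) = L (Bcontfun f) + L (Bcontfun g)"
      by (simp add: linear_add[OF L(1)])
  next
    fix f :: "'a \<Rightarrow> real" and c assume f: "continuous_on UNIV f"
    then have "Bcontfun (\<lambda>x. c * f x) = c *\<^sub>R Bcontfun f"
      by (intro bcontfun_eqI) (simp add: bc continuous_on_mult_left)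
    then show "L (Bcontfun (\<lambda>x. c * f x)) = c * L (Bcontfun f)"
      by (simp add: linear_scale[OF L(1)])
  next
    fix f :: "'a \<Rightarrow> real" assume f: "continuous_on UNIV f" "\<And>x. 0 \<le> f x"
    then have "L (- Bcontfun f) \<le> 0" by (intro Lle[of _ 0]) (simp add: bc)
    then show "0 \<le> L (Bcontfun f)" by (simp add: linear_neg[OF L(1)])
  next
    have "L (Bcontfun (\<lambda>_. 1)) \<le> 1" "L (- Bcontfun (\<lambda>_. 1)) \<le> - 1"
      by (intro Lle[of _ 0]; simp add: bc)+
    then show "L (Bcontfun (\<lambda>_. 1)) = 1" by (simp add: linear_neg[OF L(1)])
  qed
  then obtain Q where Q: "sets Q = sets borel" "prob_space Q"
    and int: "\<And>f. continuous_on UNIV f \<Longrightarrow> (LINT x|Q. f x) = L (Bcontfun f)"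
    using riesz_representation_compact by blast
  interpret prob_space Q by fact
  note [measurable_cong] = Q(1)
  have [measurable]: "S \<in> borel_measurable borel" by (rule borel_measurable_continuous_onI[OF S])
  have "distr Q borel S = Q"
  proof (rule measure_eqI_continuous)
    show "finite_measure (distr Q borel S)" by (intro finite_measure_distr) measurable
    show "finite_measure Q" by (rule finite_measure_axioms)
    fix f :: "'a \<Rightarrow> real" assume f: "continuous_on UNIV f"
    have [measurable]: "f \<in> borel_measurable borel" by (rule borel_measurable_continuous_onI[OF f])
    have fS: "continuous_on UNIV (\<lambda>x. f (S x))" using continuous_on_compose2[OF f S] by simp
    let ?f = "Bcontfun f" and ?g = "Bcontfun (\<lambda>x. f (S x))"
    have "L (?g - ?f) \<le> 0" by (rule Lle[of _ ?f]) (simp add: bc f fS)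
    moreover have "L (?f - ?g) \<le> 0" by (rule Lle[of _ "- ?f"]) (simp add: bc f fS)
    ultimately have "L ?g = L ?f" by (simp add: linear_diff[OF L(1)])
    then have "(LINT x|Q. f (S x)) = (LINT x|Q. f x)" by (simp add: int f fS)
    then show "(LINT x|distr Q borel S. f x) = (LINT x|Q. f x)"
      by (subst integral_distr) auto
  qed (use Q in auto)
  then have "invariant_prob S Q" using Q by (simp add: invariant_prob_def)
  moreover have "(LINT x|Q. apply_bcontfun h x) = L h" for h
    using int[of "apply_bcontfun h"] by (simp add: apply_bcontfun_inverse)
  ultimately show thesis by (rule that)
qed

text \<open>An invariant set \<open>A\<close> of measure strictly between 0 and 1 would make the
  functional a proper convex combination of the normalized restrictions to \<open>A\<close> and
  \<open>- A\<close>, both dominated. Extremality then identifies the restriction to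
  \<open>A\<close> with the whole functional.\<close>

theorem ergodic_prob_maximizing:
  assumes g: "continuous_on UNIV (g :: 'a \<Rightarrow> real)"
  obtains Q where "ergodic_prob S Q" "(LINT x|Q. g x) = coboundary_sup S (Bcontfun g)"
proof -
  obtain L where L: "linear L" "L \<le> coboundary_sup S"
    and Lg: "L (Bcontfun g) = coboundary_sup S (Bcontfun g)"
    and ext: "\<forall>L1 L2 t. linear L1 \<and> linear L2 \<and> L1 \<le> coboundary_sup S \<and>
      L2 \<le> coboundary_sup S \<and> 0 < t \<and> t < 1 \<and> (\<forall>x. L x = t * L1 x + (1 - t) * L2 x) \<longrightarrow> L1 = L"
    by (rule extreme_dominated_functional[OF sublinear_coboundary_sup, where g = "Bcontfun g"])
  obtain Q where Q: "invariant_prob S Q" and int: "\<And>h. (LINT x|Q. apply_bcontfun h x) = L h"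
    using invariant_prob_of_functional[OF L] by blast
  have sQ: "sets Q = sets borel" using Q by (simp add: invariant_prob_def)
  interpret prob_space Q using Q by (simp add: invariant_prob_def)
  note [measurable_cong] = sQ
  have [measurable]: "apply_bcontfun u \<in> borel_measurable borel" for u :: "'a \<Rightarrow>\<^sub>C real"
    by (rule borel_measurable_continuous_onI) simp
  have intg: "integrable Q (\<lambda>x. indicator B x * apply_bcontfun u x)"
    if [measurable]: "B \<in> sets borel" for u :: "'a \<Rightarrow>\<^sub>C real" and B
  proof -
    obtain b where "0 < b" "\<And>x. \<bar>u x\<bar> \<le> b"
      using bounded_apply_bcontfun[of u] by (auto simp: bounded_pos)
    then show ?thesis
      by (intro integrable_const_bound[of _ b]) (auto simp: indicator_def)
  qed
  define K where "K B h = (LINT x|Q. indicator B x * apply_bcontfun h x) / measure Q B"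
    for B and h :: "'a \<Rightarrow>\<^sub>C real"
  have linK: "linear (K B)" if "B \<in> sets borel" for B
    using intg[OF that]
    by (intro linearI) (auto simp: K_def distrib_left add_divide_distrib mult.left_commute)
  have leK: "K B \<le> coboundary_sup S"
    if "B \<in> sets borel" "S -` B = B" "0 < measure Q B" for B
    using invariant_integral_le_coboundary_sup[OF Q that(1,2)] that(3)
    by (auto simp: K_def le_fun_def field_simps)
  have "measure Q A = 0 \<or> measure Q A = 1" if A: "A \<in> sets borel" "S -` A = A" for A
  proof (rule ccontr)
    assume "\<not> (measure Q A = 0 \<or> measure Q A = 1)"
    then have a: "0 < measure Q A" "measure Q A < 1"
      using prob_le_1[of A] by (auto simp: zero_less_measure_iff less_le)
    have c: "- A \<in> sets borel" "S -` (- A) = - A" using A by auto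
    have mc: "measure Q (- A) = 1 - measure Q A"
      using prob_compl[of A] A(1) by (simp add: sQ sets_eq_imp_space_eq[OF sQ] Compl_eq_Diff_UNIV)
    have "K A = L"
    proof (rule ext[rule_format, of "K A" "K (- A)" "measure Q A"], intro conjI allI)
      show "linear (K A)" "linear (K (- A))" using linK A c by auto
      show "K A \<le> coboundary_sup S" "K (- A) \<le> coboundary_sup S"
        using leK[OF A a(1)] leK[OF c] mc a by auto
      show "0 < measure Q A" "measure Q A < 1" by (fact a)+
      fix h :: "'a \<Rightarrow>\<^sub>C real"
      have "L h = (LINT x|Q. indicator A x * h x + indicator (- A) x * h x)"
        unfolding int[symmetric]
        by (intro Bochner_Integration.integral_cong) (auto simp: indicator_def)
      also have "\<dots> = measure Q A * K A h + (1 - measure Q A) * K (- A) h"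
        using intg[OF A(1), of h] intg[OF c(1), of h] a mc by (simp add: K_def)
      finally show "L h = measure Q A * K A h + (1 - measure Q A) * K (- A) h" .
    qed
    then have "K A h = L h" for h by simp
    then have eq: "(LINT x|Q. indicator A x * h x) = measure Q A * (LINT x|Q. h x)"
      for h :: "'a \<Rightarrow>\<^sub>C real"
      using a unfolding int K_def by (simp add: field_simps)
    note [measurable] = A(1)
    have "density Q (\<lambda>x. ennreal (indicator A x)) = density Q (\<lambda>x. ennreal (measure Q A))"
    proof (rule measure_eqI_continuous)
      show "finite_measure (density Q (\<lambda>x. ennreal (indicator A x)))"
      proof (rule finite_measureI)
        let ?D = "density Q (\<lambda>x. ennreal (indicator A x))"
        have "emeasure ?D (space ?D) = (\<integral>\<^sup>+x. ennreal (indicator A x) * indicator (space Q) x \<partial>Q)"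
          by (subst emeasure_density) auto
        also have "\<dots> \<le> (\<integral>\<^sup>+x. 1 \<partial>Q)" by (intro nn_integral_mono) (auto simp: indicator_def)
        finally have "emeasure ?D (space ?D) \<le> 1" by (simp add: emeasure_space_1)
        then show "emeasure ?D (space ?D) \<noteq> \<infinity>" by (auto simp: top_unique)
      qed
      show "finite_measure (density Q (\<lambda>x. ennreal (measure Q A)))"
        by (rule finite_measureI) (simp add: emeasure_density emeasure_eq_measure ennreal_mult_eq_top_iff)
      fix f :: "'a \<Rightarrow> real" assume f: "continuous_on UNIV f"
      then have [measurable]: "f \<in> borel_measurable borel" by (rule borel_measurable_continuous_onI)
      show "(LINT x|density Q (\<lambda>x. ennreal (indicator A x)). f x)
          = (LINT x|density Q (\<lambda>x. ennreal (measure Q A)). f x)"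
        using eq[of "Bcontfun f"] by (simp add: integral_density apply_bcontfun_Bcontfun[OF comp f])
    qed (simp_all add: sQ)
    \<comment> \<open>Evaluated at \<open>A\<close> itself, the two densities give that the measure
      of \<open>A\<close> equals its square, which is impossible strictly between 0 and 1.\<close>
    then have "emeasure (density Q (\<lambda>x. ennreal (indicator A x))) A
        = emeasure (density Q (\<lambda>x. ennreal (measure Q A))) A" by simp
    then have "ennreal (measure Q A) = ennreal (measure Q A * measure Q A)"
      using A by (simp add: emeasure_density sQ emeasure_eq_measure ennreal_indicator
          nn_integral_cmult_indicator ennreal_mult flip: indicator_inter_arith)
    then show False using a by simp
  qed
  then have "ergodic_prob S Q" using Q by (simp add: ergodic_prob_def)
  moreover have "(LINT x|Q. g x) = coboundary_sup S (Bcontfun g)"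
    using int[of "Bcontfun g"] Lg by (simp add: apply_bcontfun_Bcontfun[OF comp g])
  ultimately show thesis by (rule that)
qed

end

section \<open>Powers of a uniquely weakly mixing system\<close>

text \<open>The set \<open>B\<close> where the derivative \<open>h\<close> exceeds 1 is invariant up
  to a null set, hence of measure 0 or 1 by ergodicity. Measure 1 would give \<open>Q\<close> total
  mass above 1, so \<open>h\<close> is at most 1 almost everywhere; then \<open>Q\<close> lies below
  \<open>P\<close>, and equal total mass makes them equal.\<close>

lemma ergodic_absolutely_continuous_eq:
  fixes P Q :: "'a::metric_space measure"
  assumes S [measurable]: "S \<in> borel_measurable borel"
    and P: "ergodic_prob S P" and Q: "invariant_prob S Q" and ac: "absolutely_continuous P Q"
  shows "Q = P"
proof -
  have sP [measurable_cong]: "sets P = sets borel" and dP: "distr P borel S = P"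
    and sQ [measurable_cong]: "sets Q = sets borel" and dQ: "distr Q borel S = Q"
    using P Q by (auto simp: ergodic_prob_def invariant_prob_def)
  interpret P: prob_space P using P by (simp add: ergodic_prob_def invariant_prob_def)
  interpret Q: prob_space Q using Q by (simp add: invariant_prob_def)
  have spP: "space P = UNIV" and spQ: "space Q = UNIV"
    using sets_eq_imp_space_eq[OF sP] sets_eq_imp_space_eq[OF sQ] by auto
  define h where "h = RN_deriv P Q"
  have [measurable]: "h \<in> borel_measurable borel"
    using borel_measurable_RN_deriv[of P Q] measurable_cong_sets[OF sP refl] by (auto simp: h_def)
  have "density P h = Q"
    unfolding h_def by (rule P.density_RN_deriv[OF ac]) (simp add: sP sQ)
  then have emQ: "emeasure Q A = (\<integral>\<^sup>+x. h x * indicator A x \<partial>P)" if "A \<in> sets borel" for A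
    using that by (metis \<open>h \<in> borel_measurable borel\<close> emeasure_density measurable_cong_sets sP)
  define B where "B = {x. 1 < h x}"
  have [measurable]: "B \<in> sets borel" unfolding B_def by measurable
  have null: "emeasure P D = 0"
    if [measurable]: "D \<in> sets borel" and D: "D \<subseteq> B" "emeasure Q D \<le> emeasure P D" for D
  proof -
    \<comment> \<open>The subtraction in \<open>ennreal\<close> is truncated; inside
      \<open>B\<close>, where \<open>h\<close> exceeds 1, it is a true and positive
      difference.\<close>
    have "emeasure Q D = (\<integral>\<^sup>+x. (h x - 1) * indicator D x + indicator D x \<partial>P)"
      unfolding emQ[OF that(1)]
    proof (intro nn_integral_cong)
      fix x
      show "h x * indicator D x = (h x - 1) * indicator D x + indicator D x"
        using D(1) by (auto simp: indicator_def B_def diff_add_cancel_ennreal less_imp_le)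
    qed
    also have "\<dots> = (\<integral>\<^sup>+x. (h x - 1) * indicator D x \<partial>P) + emeasure P D"
      by (subst nn_integral_add) auto
    finally have "emeasure P D + (\<integral>\<^sup>+x. (h x - 1) * indicator D x \<partial>P) \<le> emeasure P D + 0"
      using D(2) by (simp add: add.commute)
    then have "(\<integral>\<^sup>+x. (h x - 1) * indicator D x \<partial>P) = 0"
      unfolding ennreal_add_left_cancel_le using P.emeasure_finite[of D] by simp
    then have "AE x in P. (h x - 1) * indicator D x = 0"
      by (subst (asm) nn_integral_0_iff_AE) auto
    then have "AE x in P. x \<notin> D"
    proof (rule AE_mp, intro AE_I2 impI)
      fix x assume "(h x - 1) * indicator D x = 0"
      then show "x \<notin> D" using D(1)
        by (auto simp: B_def indicator_def diff_eq_0_iff_ennreal split: if_splits)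
    qed
    then show ?thesis
      by (subst (asm) AE_iff_measurable[of D]) (auto simp: spP sP)
  qed
  have invP: "emeasure P (S -` A) = emeasure P A" if "A \<in> sets borel" for A
    using emeasure_distr[of S P borel A] that by (simp add: dP spP)
  have invQ: "emeasure Q (S -` A) = emeasure Q A" if "A \<in> sets borel" for A
    using emeasure_distr[of S Q borel A] that by (simp add: dQ spQ)
  have SB [measurable]: "S -` B \<in> sets borel"
    using measurable_sets[OF S, of B] by simp
  have swap: "emeasure R (B - S -` B) = emeasure R (S -` B - B)"
    if "finite_measure R" "sets R = sets borel" "emeasure R (S -` B) = emeasure R B" for R
  proof -
    interpret finite_measure R by fact
    have "emeasure R (B - S -` B) = emeasure R B - emeasure R (B \<inter> S -` B)"
      by (subst emeasure_Diff[symmetric]) (auto simp: that(2) intro!: arg_cong[of _ _ "emeasure R"])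
    moreover have "emeasure R (S -` B - B) = emeasure R (S -` B) - emeasure R (B \<inter> S -` B)"
      by (subst emeasure_Diff[symmetric]) (auto simp: that(2) intro!: arg_cong[of _ _ "emeasure R"])
    ultimately show ?thesis using that(3) by simp
  qed
  have "emeasure Q (S -` B - B) = (\<integral>\<^sup>+x. h x * indicator (S -` B - B) x \<partial>P)"
    by (rule emQ) measurable
  also have "\<dots> \<le> (\<integral>\<^sup>+x. indicator (S -` B - B) x \<partial>P)"
    by (intro nn_integral_mono) (auto simp: B_def indicator_def)
  also have "\<dots> = emeasure P (S -` B - B)" by (rule nn_integral_indicator) (simp add: sP)
  \<comment> \<open>For each of the two measures, as much mass leaves \<open>B\<close> under
    \<open>S\<close> as enters it. So the inequality found on the entering points, which lie outside
    \<open>B\<close>, carries over to the leaving points, which lie inside.\<close>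
  finally have "emeasure Q (B - S -` B) \<le> emeasure P (B - S -` B)"
    using swap[OF P.finite_measure_axioms sP invP] swap[OF Q.finite_measure_axioms sQ invQ] by simp
  then have "emeasure P (B - S -` B) = 0" by (intro null) auto
  moreover from this have "emeasure P (S -` B - B) = 0"
    using swap[OF P.finite_measure_axioms sP invP] by simp
  ultimately have "B - S -` B \<in> null_sets P" "S -` B - B \<in> null_sets P"
    by (auto intro!: null_setsI simp: sP)
  then have "AE x in P. x \<notin> B - S -` B" "AE x in P. x \<notin> S -` B - B"
    by (auto dest: AE_not_in)
  then have ae: "AE x in P. x \<in> B \<longleftrightarrow> S x \<in> B" by eventually_elim auto
  have ae_all: "AE x in P. x \<in> B \<longleftrightarrow> (S ^^ m) x \<in> B" for m
  proof (induction m)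
    case (Suc m)
    have "AE x in distr P borel S. x \<in> B \<longleftrightarrow> (S ^^ m) x \<in> B"
      unfolding dP by (rule Suc)
    then have "AE x in P. S x \<in> B \<longleftrightarrow> (S ^^ m) (S x) \<in> B"
      by (subst (asm) AE_distr_iff) auto
    with ae show ?case by eventually_elim (simp add: funpow_swap1)
  qed simp
  \<comment> \<open>\<open>ergodic_prob\<close> speaks of strictly invariant sets. Visiting
    \<open>B\<close> infinitely often does not depend on the first point of the orbit, so
    \<open>B'\<close> is strictly invariant, and it agrees with \<open>B\<close> almost
    everywhere.\<close>
  define B' where "B' = {x. \<exists>\<^sub>F m in sequentially. (S ^^ m) x \<in> B}"
  have [measurable]: "B' \<in> sets borel"
  proof -
    have "B' = (\<Inter>n. \<Union>m\<in>{n..}. (S ^^ m) -` B)"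
      by (auto simp: B'_def frequently_sequentially Bex_def)
    moreover have "(S ^^ m) -` B \<in> sets borel" for m
      using measurable_sets[of "S ^^ m" borel borel B] by simp
    ultimately show ?thesis by auto
  qed
  have "S -` B' = B'"
  proof -
    have "(\<exists>\<^sub>F m in sequentially. (S ^^ Suc m) x \<in> B) \<longleftrightarrow> (\<exists>\<^sub>F m in sequentially. (S ^^ m) x \<in> B)" for x
      unfolding frequently_def by (subst eventually_sequentially_Suc) simp
    then show ?thesis by (auto simp: B'_def funpow_swap1)
  qed
  then have "measure P B' = 0 \<or> measure P B' = 1"
    using P by (simp add: ergodic_prob_def)
  moreover have "AE x in P. x \<in> B \<longleftrightarrow> x \<in> B'"
  proof -
    have "AE x in P. \<forall>m. x \<in> B \<longleftrightarrow> (S ^^ m) x \<in> B" using ae_all by (simp add: AE_all_countable)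
    then show ?thesis by eventually_elim (auto simp: B'_def)
  qed
  then have "measure P B = measure P B'" by (intro P.finite_measure_eq_AE) (auto simp: sP)
  moreover have "measure P B \<noteq> 1"
  proof
    assume 1: "measure P B = 1"
    then have "emeasure P B = 0"
      using Q.prob_le_1[of B] by (intro null) (auto simp: P.emeasure_eq_measure Q.emeasure_eq_measure)
    then show False using 1 by (simp add: measure_def)
  qed
  ultimately have "measure P B = 0" by simp
  then have "AE x in P. x \<notin> B"
    by (intro AE_not_in null_setsI) (auto simp: sP P.emeasure_eq_measure)
  then have h1: "AE x in P. h x \<le> 1" by eventually_elim (simp add: B_def not_less)
  have le: "measure Q A \<le> measure P A" if A: "A \<in> sets borel" for A
  proof -
    have "emeasure Q A \<le> (\<integral>\<^sup>+x. indicator A x \<partial>P)"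
      unfolding emQ[OF A]
    proof (rule nn_integral_mono_AE)
      show "AE x in P. h x * indicator A x \<le> indicator A x"
        using h1 by eventually_elim (auto simp: indicator_def)
    qed
    also have "\<dots> = emeasure P A" using A by (simp add: sP)
    finally show ?thesis by (simp add: P.emeasure_eq_measure Q.emeasure_eq_measure)
  qed
  show ?thesis
  proof (rule measure_eqI)
    fix A assume "A \<in> sets Q"
    then have A: "A \<in> sets borel" by (simp add: sQ)
    have "1 - measure Q A \<le> 1 - measure P A"
      using le[of "- A"] A P.prob_compl[of A] Q.prob_compl[of A]
      by (simp add: sP sQ spP spQ Compl_eq_Diff_UNIV)
    then show "emeasure Q A = emeasure P A"
      using le[OF A] by (simp add: P.emeasure_eq_measure Q.emeasure_eq_measure)
  qed (simp add: sP sQ)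
qed

section \<open>Eigenfunctions and their spectral measures\<close>

lemma eigenfunction_iterate:
  fixes c :: complex
  assumes T: "bij T" and g: "\<And>x. g (T x) = exp c * g x"
  shows "g (iterate_int T k x) = exp (of_int k * c) * g x"
proof -
  have pos: "g ((T ^^ n) x) = exp (of_nat n * c) * g x" for n x
    by (induction n) (auto simp: g exp_add algebra_simps)
  have inv: "g (inv T x) = exp (- c) * g x" for x
  proof -
    have "exp c * g (inv T x) = g x"
      using g[of "inv T x"] T by (simp add: bij_is_surj surj_f_inv_f)
    then show ?thesis by (simp add: exp_minus field_simps)
  qed
  have neg: "g ((inv T ^^ n) x) = exp (- (of_nat n * c)) * g x" for n x
    by (induction n) (auto simp: inv exp_add[symmetric] algebra_simps exp_minus[symmetric])
  show ?thesis
  proof (cases "k \<ge> 0")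
    case True
    then show ?thesis using pos[of "nat k"] by (simp add: iterate_int_def)
  next
    case False
    then show ?thesis using neg[of "nat (- k)"] by (simp add: iterate_int_def)
  qed
qed

text \<open>The spectral measure of an eigenfunction is the explicit point mass at its angle, so no
  existence theorem for spectral measures is needed.\<close>

lemma weakly_mixing_eigenfunction_zero:
  fixes T :: "'a::metric_space \<Rightarrow> 'a" and g :: "'a \<Rightarrow> complex"
  assumes uwm: "uniquely_weakly_mixing T P" and T: "bij T"
    and g [measurable]: "g \<in> borel_measurable borel" and bnd: "\<And>x. cmod (g x) \<le> C"
    and \<theta>: "0 < \<theta>" "\<theta> < 2 * pi"
    and eig: "\<And>x. g (T x) = exp (- \<i> * complex_of_real \<theta>) * g x"
  shows "AE x in P. g x = 0"
proof -
  have sP [measurable_cong]: "sets P = sets borel" and pP: "prob_space P"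
    using uwm by (auto simp: uniquely_weakly_mixing_def ergodic_prob_def invariant_prob_def)
  interpret prob_space P by (rule pP)
  obtain \<sigma> \<kappa> where max: "is_maximal_spectral_measure T P \<sigma>"
    and dpc: "dirac_plus_continuous \<kappa>" and equ: "equivalent_measures \<sigma> \<kappa>"
    using uwm by (auto simp: uniquely_weakly_mixing_def)
  define c where "c = (LINT x|P. (cmod (g x))\<^sup>2)"
  have int: "integrable P (\<lambda>x. (cmod (g x))\<^sup>2)"
    using bnd by (intro integrable_const_bound[of _ "C\<^sup>2"]) (auto intro!: AE_I2 power_mono)
  have c: "0 \<le> c" unfolding c_def by (intro integral_nonneg_AE) auto
  have sp: "space circle = {0..<2 * pi}" by (simp add: circle_def space_restrict_space)
  have \<theta>c: "\<theta> \<in> space circle" using \<theta> by (simp add: sp)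
  have s\<theta>: "{\<theta>} \<in> sets circle" using \<theta> by (auto simp: circle_def sets_restrict_space_iff)
  have ps: "prob_space (return circle \<theta>)" using \<theta>c by (rule prob_space_return)
  \<comment> \<open>The mass \<open>c\<close> is the squared norm of \<open>g\<close>, as the case
    \<open>k = 0\<close> demands. The eigenvalue has the same sign in its exponent as the kernel of
    the spectral measure, so the mass sits at \<theta> itself.\<close>
  define \<tau> where "\<tau> = density (return circle \<theta>) (\<lambda>_. ennreal c)"
  have \<tau>: "emeasure \<tau> A = ennreal c * indicator A \<theta>" if "A \<in> sets circle" for A
    using that by (simp add: \<tau>_def emeasure_density nn_integral_cmult_indicator)
  have "is_spectral_measure T P g \<tau>"
    unfolding is_spectral_measure_def
  proof (intro conjI allI)
    show "sets \<tau> = sets circle" by (simp add: \<tau>_def)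
    have "space \<tau> = space circle" by (simp add: \<tau>_def)
    then show "finite_measure \<tau>"
      using \<tau>[of "space circle"] by (intro finite_measureI) (auto simp: indicator_def)
    fix k :: int
    have meas: "(\<lambda>t. exp (- \<i> * of_int k * complex_of_real t)) \<in> borel_measurable circle"
      unfolding circle_def
      by (intro measurable_restrict_space1 borel_measurable_continuous_onI continuous_intros)
    have "(LINT t|\<tau>. exp (- \<i> * of_int k * complex_of_real t))
        = (LINT t|return circle \<theta>. c *\<^sub>R exp (- \<i> * of_int k * complex_of_real t))"
      unfolding \<tau>_def
    proof (rule integral_density)
      show "(\<lambda>t. exp (- \<i> * of_int k * complex_of_real t)) \<in> borel_measurable (return circle \<theta>)"
        using meas by (subst measurable_cong_sets[OF sets_return refl])
    qed (use c in auto)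
    also have "\<dots> = c *\<^sub>R exp (- \<i> * of_int k * complex_of_real \<theta>)"
      by (intro integral_return \<theta>c borel_measurable_scaleR borel_measurable_const meas)
    also have "\<dots> = (LINT x|P. exp (- \<i> * of_int k * complex_of_real \<theta>) * complex_of_real ((cmod (g x))\<^sup>2))"
      using int by (simp add: c_def scaleR_conv_of_real mult.commute del: of_real_power)
    also have "\<dots> = (LINT x|P. g (iterate_int T k x) * cnj (g x))"
    proof (intro Bochner_Integration.integral_cong refl)
      fix x
      show "exp (- \<i> * of_int k * complex_of_real \<theta>) * complex_of_real ((cmod (g x))\<^sup>2)
          = g (iterate_int T k x) * cnj (g x)"
        unfolding eigenfunction_iterate[where g = g, OF T eig] complex_norm_square
        by (simp add: ac_simps)
    qed
    finally show "(LINT t|\<tau>. exp (- \<i> * of_int k * complex_of_real t))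
        = (LINT x|P. g (iterate_int T k x) * cnj (g x))" .
  qed
  moreover have "g \<in> L2 P" using int by (simp add: L2_def)
  ultimately have "absolutely_continuous \<sigma> \<tau>"
    using max by (auto simp: is_maximal_spectral_measure_def)
  \<comment> \<open>The Dirac part sits at 0, which differs from \<theta>, and the other part has no
    atoms.\<close>
  moreover have "{\<theta>} \<in> null_sets \<kappa>"
    using dpc s\<theta> \<theta> \<theta>c by (auto simp: dirac_plus_continuous_def continuous_circle_measure_def)
  moreover have "absolutely_continuous \<kappa> \<sigma>" using equ by (simp add: equivalent_measures_def)
  ultimately have "{\<theta>} \<in> null_sets \<tau>" by (auto simp: absolutely_continuous_def)
  then have "c = 0" using \<tau>[OF s\<theta>] c by (auto simp: null_sets_def)
  then have "AE x in P. (cmod (g x))\<^sup>2 = 0"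
    using int by (subst (asm) c_def) (simp add: integral_nonneg_eq_0_iff_AE)
  then show ?thesis by simp
qed

section \<open>Invariance under powers\<close>

lemma shift_sum_periodic:
  fixes a :: "nat \<Rightarrow> 'b::ab_group_add"
  assumes "a M = a 0"
  shows "(\<Sum>i<M. a (Suc i)) = (\<Sum>i<M. a i)"
proof -
  have "a 0 + (\<Sum>i<M. a (Suc i)) = (\<Sum>i<M. a i) + a M"
    by (simp add: sum.lessThan_Suc_shift[symmetric])
  then show ?thesis using assms by (simp add: add.commute)
qed

lemma all_less_Suc_periodic:
  fixes M :: nat
  assumes "0 < M" "p M = p 0"
  shows "(\<forall>i<M. p (Suc i)) \<longleftrightarrow> (\<forall>i<M. p i)"
proof -
  obtain m where "M = Suc m" using assms(1) by (auto simp: gr0_conv_Suc)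
  then show ?thesis
    using assms(2) All_less_Suc[of m "\<lambda>i. p (Suc i)"] All_less_Suc2[of m p] by simp
qed

lemma invariant_prob_vimage:
  assumes "invariant_prob T P" "T \<in> borel_measurable borel" "A \<in> sets borel"
  shows "emeasure P (T -` A) = emeasure P A"
proof -
  have sP: "sets P = sets borel" and dP: "distr P borel T = P"
    using assms(1) by (auto simp: invariant_prob_def)
  then show ?thesis
    using emeasure_distr[of T P borel A] assms measurable_cong_sets[OF sP refl, of borel]
    by (simp add: sets_eq_imp_space_eq[OF sP])
qed

lemma invariant_prob_funpow:
  assumes P: "invariant_prob T P" and T [measurable]: "T \<in> borel_measurable borel"
  shows "invariant_prob (T ^^ n) P"
proof -
  have sP [measurable_cong]: "sets P = sets borel" using P by (simp add: invariant_prob_def)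
  have "distr P borel (T ^^ n) = P"
  proof (induction n)
    case 0
    show ?case by (simp add: distr_id2[OF sP[symmetric]] id_def)
  next
    case (Suc n)
    have "distr P borel (T ^^ Suc n) = distr (distr P borel (T ^^ n)) borel T"
      by (subst distr_distr) (auto simp: comp_def)
    then show ?case using Suc P by (simp add: invariant_prob_def del: funpow.simps)
  qed
  then show ?thesis using P by (simp add: invariant_prob_def)
qed

text \<open>For a set \<open>A\<close> invariant under \<open>T ^^ M\<close>, the sums \<open>\<Sum>i<M. \<omega>\<^sup>i\<^sup>j indicator A (T\<^sup>i x)\<close> with
  \<open>0 < j < M\<close> are eigenfunctions of \<open>T\<close>, so they vanish, and \<open>A\<close> agrees with a \<open>T\<close>-invariant set.\<close>

lemma weakly_mixing_ergodic_funpow: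
  fixes T :: "'a::metric_space \<Rightarrow> 'a"
  assumes uwm: "uniquely_weakly_mixing T P" and T: "bij T"
    and mT [measurable]: "T \<in> borel_measurable borel" and M: "0 < M"
  shows "ergodic_prob (T ^^ M) P"
proof -
  have erg: "ergodic_prob T P" using uwm by (simp add: uniquely_weakly_mixing_def)
  then have P: "invariant_prob T P" by (simp add: ergodic_prob_def)
  then have sP: "sets P = sets borel" and pP: "prob_space P" by (auto simp: invariant_prob_def)
  interpret prob_space P by (rule pP)
  have "measure P A = 0 \<or> measure P A = 1"
    if A: "A \<in> sets borel" and inv: "(T ^^ M) -` A = A" for A
  proof -
    note [measurable] = A
    define a :: "nat \<Rightarrow> 'a \<Rightarrow> complex" where "a i x = indicator A ((T ^^ i) x)" for i x
    have aM: "a M x = a 0 x" for x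
      using inv by (auto simp: a_def indicator_def)
    have aS: "a i (T x) = a (Suc i) x" for i x by (simp add: a_def funpow_swap1)
    define \<theta> where "\<theta> j = 2 * pi * real j / real M" for j
    define g where "g j x = (\<Sum>i<M. cis (\<theta> j * real i) * a i x)" for j x
    have [measurable]: "g j \<in> borel_measurable borel" for j
      unfolding g_def a_def by measurable
    have "g j (T x) = exp (- \<i> * complex_of_real (\<theta> j)) * g j x" for j x
    proof -
      have "cis (\<theta> j * real M) = 1"
        using M cis_multiple_2pi[of "real j"] by (simp add: \<theta>_def)
      then have per: "cis (\<theta> j * real M) * a M x = cis (\<theta> j * real 0) * a 0 x"
        by (simp add: aM)
      have "g j (T x) = (\<Sum>i<M. cis (- \<theta> j) * (cis (\<theta> j * real (Suc i)) * a (Suc i) x))"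
        unfolding g_def aS
      proof (intro sum.cong refl)
        fix i
        have "cis (- \<theta> j) * cis (\<theta> j * real (Suc i)) = cis (\<theta> j * real i)"
          by (simp add: cis_mult algebra_simps)
        then show "cis (\<theta> j * real i) * a (Suc i) x
            = cis (- \<theta> j) * (cis (\<theta> j * real (Suc i)) * a (Suc i) x)"
          by (metis mult.assoc)
      qed
      also have "\<dots> = cis (- \<theta> j) * (\<Sum>i<M. cis (\<theta> j * real i) * a i x)"
        unfolding sum_distrib_left[symmetric]
        using shift_sum_periodic[of "\<lambda>i. cis (\<theta> j * real i) * a i x" M, OF per] by simp
      finally show ?thesis by (simp add: g_def cis_conv_exp)
    qed
    moreover have "cmod (g j x) \<le> real M" for j x
    proof -
      have "cmod (g j x) \<le> (\<Sum>i<M. cmod (cis (\<theta> j * real i) * a i x))"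
        unfolding g_def by (rule norm_sum)
      also have "\<dots> \<le> (\<Sum>i<M. 1)"
        by (intro sum_mono) (auto simp: norm_mult a_def indicator_def)
      finally show ?thesis by simp
    qed
    moreover have "0 < \<theta> j \<and> \<theta> j < 2 * pi" if "j \<in> {1..<M}" for j
      using that M by (simp add: \<theta>_def divide_simps)
    ultimately have "AE x in P. g j x = 0" if "j \<in> {1..<M}" for j
      using that by (intro weakly_mixing_eigenfunction_zero[OF uwm T, where \<theta> = "\<theta> j"]) auto
    then have ae: "AE x in P. \<forall>j\<in>{1..<M}. g j x = 0" by (intro AE_finite_allI) auto
    have roots: "(\<Sum>j<M. cis (\<theta> j * real i)) = 0" if i: "i \<in> {1..<M}" for i
    proof -
      define w where "w = cis (2 * pi * real i / real M)"
      have "w \<noteq> 1"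
      proof
        assume "w = 1"
        then have "cos (2 * pi * real i / real M) = 1" by (simp add: w_def complex_eq_iff)
        then obtain k :: int where "2 * pi * real i / real M = of_int k * 2 * pi"
          unfolding cos_one_2pi_int by (auto simp: mult.commute)
        then have "real i = of_int k * real M" using M by (simp add: field_simps)
        then have "int i = k * int M" by (metis of_int_eq_iff of_int_mult of_int_of_nat_eq)
        then have "int M dvd int i" by simp
        then show False using i by (auto dest: dvd_imp_le)
      qed
      moreover have "w ^ M = 1"
      proof -
        have "w ^ M = cis (real M * (2 * pi * real i / real M))"
          unfolding w_def by (rule Complex.DeMoivre)
        also have "real M * (2 * pi * real i / real M) = 2 * pi * real i" using M by simp
        also have "cis (2 * pi * real i) = 1" by (rule cis_multiple_2pi) simp
        finally show ?thesis .
      qed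
      moreover have "(\<Sum>j<M. cis (\<theta> j * real i)) = (\<Sum>j<M. w ^ j)"
        unfolding w_def Complex.DeMoivre by (intro sum.cong refl arg_cong[of _ _ cis]) (simp add: \<theta>_def)
      ultimately show ?thesis by (simp add: geometric_sum)
    qed
    \<comment> \<open>Inversion of the finite Fourier transform: summing over all frequencies leaves
      only the term \<open>i = 0\<close>.\<close>
    have total: "(\<Sum>j<M. g j x) = of_nat M * a 0 x" for x
    proof -
      have "(\<Sum>j<M. g j x) = (\<Sum>i<M. (\<Sum>j<M. cis (\<theta> j * real i)) * a i x)"
        unfolding g_def by (subst sum.swap) (simp add: sum_distrib_right)
      also have "\<dots> = (\<Sum>i\<in>{0}. (\<Sum>j<M. cis (\<theta> j * real i)) * a i x)"
        using M roots by (intro sum.mono_neutral_right) auto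
      finally show ?thesis by simp
    qed
    define B where "B = {x. \<forall>i<M. (T ^^ i) x \<in> A}"
    have Bm: "B \<in> sets borel"
    proof -
      have "B = (\<Inter>i\<in>{..<M}. (T ^^ i) -` A)" by (auto simp: B_def)
      moreover have "(T ^^ i) -` A \<in> sets borel" for i
        using measurable_sets[of "T ^^ i" borel borel A] by simp
      ultimately show ?thesis using M by (auto intro!: sets.finite_INT)
    qed
    have "T -` B = B"
    proof -
      have iff: "(\<forall>i<M. (T ^^ Suc i) x \<in> A) \<longleftrightarrow> (\<forall>i<M. (T ^^ i) x \<in> A)" for x
        using inv by (intro all_less_Suc_periodic M) auto
      have "T x \<in> B \<longleftrightarrow> x \<in> B" for x
        using iff[of x] by (simp add: B_def funpow_swap1)
      then show ?thesis by auto
    qed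
    then have "measure P B = 0 \<or> measure P B = 1"
      using erg Bm by (simp add: ergodic_prob_def)
    moreover have "AE x in P. x \<in> A \<longleftrightarrow> x \<in> B"
      using ae
    proof eventually_elim
      case (elim x)
      have "(\<Sum>j<M. g j x) = (\<Sum>j\<in>{0}. g j x)"
        using M elim by (intro sum.mono_neutral_right) auto
      \<comment> \<open>Only frequency 0 survives, so \<open>a 0 x\<close> equals the average of the
        \<open>M\<close> values \<open>a i x\<close>. If it is 1, all of them are 1, so the points
        \<open>(T ^^ i) x\<close> with \<open>i < M\<close> all lie in \<open>A\<close>.\<close>
      then have eq: "of_nat M * a 0 x = (\<Sum>i<M. a i x)"
        using total[of x] by (simp add: g_def \<theta>_def)
      show ?case
      proof
        assume "x \<in> A"
        then have "a 0 x = 1" by (simp add: a_def)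
        have "real M = Re (\<Sum>i<M. a i x)"
          using eq \<open>a 0 x = 1\<close>
          by (metis mult.right_neutral Re_complex_of_real of_real_of_nat_eq)
        then have "(\<Sum>i<M. 1 - Re (a i x)) = 0" by (simp add: sum_subtractf)
        then have one: "1 - Re (a i x) = 0" if "i < M" for i
          using that by (subst (asm) sum_nonneg_eq_0_iff) (auto simp: a_def indicator_def)
        have "(T ^^ i) x \<in> A" if "i < M" for i
          using one[OF that] by (cases "(T ^^ i) x \<in> A") (auto simp: a_def)
        then show "x \<in> B" by (simp add: B_def)
      next
        assume "x \<in> B"
        then show "x \<in> A" using M by (auto simp: B_def)
      qed
    qed
    then have "measure P A = measure P B"
      by (intro finite_measure_eq_AE) (auto simp: sP Bm A)
    ultimately show ?thesis by simp
  qed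
  then show ?thesis
    using invariant_prob_funpow[OF P mT] by (simp add: ergodic_prob_def)
qed

lemma averaged_measure_exists:
  fixes Q :: "'a::metric_space measure" and T :: "'a \<Rightarrow> 'a"
  assumes sQ: "sets Q = sets borel" and mT [measurable]: "T \<in> borel_measurable borel"
  obtains R where "sets R = sets borel"
    "\<And>A. A \<in> sets borel \<Longrightarrow> emeasure R A = (\<Sum>i<M. emeasure Q ((T ^^ i) -` A)) / of_nat M"
proof -
  define \<mu> where "\<mu> A = (\<Sum>i<M. emeasure Q ((T ^^ i) -` A)) / of_nat M" for A
  define R where "R = measure_of UNIV (sets borel) \<mu>"
  have sR: "sets R = sets borel"
    by (simp add: R_def sets.sigma_sets_eq[of borel, simplified])
  have "countably_additive (sets R) \<mu>"
  proof (rule countably_additiveI)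
    fix A :: "nat \<Rightarrow> 'a set"
    assume A: "range A \<subseteq> sets R" "disjoint_family A"
    have "(\<Sum>n. emeasure Q ((T ^^ i) -` A n)) = emeasure Q ((T ^^ i) -` (\<Union>n. A n))" for i
      unfolding vimage_UN
    proof (rule suminf_emeasure)
      show "range (\<lambda>n. (T ^^ i) -` A n) \<subseteq> sets Q"
        using A(1) measurable_sets[of "T ^^ i" borel borel] by (auto simp: sR sQ image_subset_iff)
      show "disjoint_family (\<lambda>n. (T ^^ i) -` A n)"
        using A(2) by (auto simp: disjoint_family_on_def)
    qed
    then show "(\<Sum>n. \<mu> (A n)) = \<mu> (\<Union>n. A n)"
      unfolding \<mu>_def divide_ennreal_def by (simp add: suminf_sum)
  qed
  then have "emeasure R A = \<mu> A" if "A \<in> sets borel" for A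
    by (intro emeasure_measure_of[OF R_def]) (auto simp: positive_def \<mu>_def that sR)
  then show thesis using that[OF sR] by (simp add: \<mu>_def)
qed

text \<open>Once the average \<open>R\<close> is known to be \<open>P\<close>, every null set of
  \<open>P\<close> is null for \<open>Q\<close>, which is one of the summands. Ergodicity of
  \<open>P\<close> under \<open>T ^^ M\<close> then leaves only \<open>Q = P\<close>.\<close>

lemma weakly_mixing_funpow_unique:
  fixes T :: "'a::metric_space \<Rightarrow> 'a"
  assumes uwm: "uniquely_weakly_mixing T P" and T: "bij T"
    and mT [measurable]: "T \<in> borel_measurable borel" and M: "0 < M"
    and Q: "ergodic_prob (T ^^ M) Q"
  shows "Q = P"
proof -
  have iQ: "invariant_prob (T ^^ M) Q" using Q by (simp add: ergodic_prob_def)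
  then have sQ: "sets Q = sets borel" and pQ: "prob_space Q"
    by (auto simp: invariant_prob_def)
  interpret Q: prob_space Q by (rule pQ)
  have spQ: "space Q = UNIV" using sets_eq_imp_space_eq[OF sQ] by simp
  have iter [measurable]: "(T ^^ i) -` A \<in> sets borel" if "A \<in> sets borel" for i A
    using measurable_sets[of "T ^^ i" borel borel A] that by simp
  obtain R where sR: "sets R = sets borel"
    and R: "\<And>A. A \<in> sets borel \<Longrightarrow> emeasure R A = (\<Sum>i<M. emeasure Q ((T ^^ i) -` A)) / of_nat M"
    using averaged_measure_exists[OF sQ mT] by blast
  have spR: "space R = UNIV" using sets_eq_imp_space_eq[OF sR] by simp
  have [measurable_cong]: "sets R = sets borel" by (rule sR)
  have Mdiv: "of_nat M * x / of_nat M = x" for x :: ennreal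
    using M by (simp add: ennreal_mult_divide_eq mult.commute ennreal_of_nat_eq_real_of_nat)
  have inv: "emeasure R (T -` A) = emeasure R A" if A: "A \<in> sets borel" for A
  proof -
    \<comment> \<open>The sums are moved to the reals because the cyclic shift cancels a
      term.\<close>
    let ?a = "\<lambda>i. measure Q ((T ^^ i) -` A)"
    have "?a M = ?a 0"
      using invariant_prob_vimage[OF iQ _ A] by (simp add: measure_def)
    then have "(\<Sum>i<M. ?a (Suc i)) = (\<Sum>i<M. ?a i)" by (rule shift_sum_periodic)
    moreover have "(T ^^ i) -` (T -` A) = (T ^^ Suc i) -` A" for i by auto
    moreover have "T -` A \<in> sets borel" using iter[OF A, of 1] by simp
    ultimately show ?thesis
      using R A by (simp add: Q.emeasure_eq_measure del: funpow.simps)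
  qed
  have "invariant_prob T R"
    unfolding invariant_prob_def
  proof (intro conjI sR)
    show "prob_space R"
      using R[of UNIV] Q.emeasure_space_1 Mdiv[of 1] by (intro prob_spaceI) (simp add: spR spQ)
    show "distr R borel T = R"
    proof (rule measure_eqI)
      fix A assume "A \<in> sets (distr R borel T)"
      then have "A \<in> sets borel" by simp
      then show "emeasure (distr R borel T) A = emeasure R A"
        by (subst emeasure_distr) (auto simp: spR inv)
    qed (simp add: sR)
  qed
  \<comment> \<open>On a set invariant under \<open>T\<close> all summands agree, so
    \<open>R\<close> equals \<open>Q\<close> there; such a set is also invariant under
    \<open>T ^^ M\<close>, where \<open>Q\<close> is ergodic.\<close>
  moreover have "measure R A = 0 \<or> measure R A = 1" if A: "A \<in> sets borel" "T -` A = A" for A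
  proof -
    have it: "(T ^^ i) -` A = A" for i
      by (induction i) (use A(2) in \<open>auto simp: set_eq_iff\<close>)
    then have "emeasure R A = emeasure Q A" using R[OF A(1)] Mdiv by simp
    then show ?thesis using Q it[of M] A(1) by (simp add: ergodic_prob_def measure_def)
  qed
  ultimately have "ergodic_prob T R" by (simp add: ergodic_prob_def)
  then have RP: "R = P" using uwm by (auto simp: uniquely_weakly_mixing_def)
  have "absolutely_continuous P Q"
    unfolding absolutely_continuous_def
  proof
    fix A assume "A \<in> null_sets P"
    then have A: "A \<in> sets borel" and "emeasure R A = 0" using RP sR by (auto simp: null_sets_def)
    then have "(\<Sum>i<M. emeasure Q ((T ^^ i) -` A)) = 0"
      using R[OF A] by (simp add: ennreal_divide_eq_0_iff)
    then have "emeasure Q ((T ^^ 0) -` A) = 0" using M by (simp del: funpow.simps)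
    then show "A \<in> null_sets Q" using A by (simp add: sQ null_sets_def)
  qed
  then show ?thesis
    by (intro ergodic_absolutely_continuous_eq[of "T ^^ M"] iQ
        weakly_mixing_ergodic_funpow[OF uwm T mT M]) auto
qed

section \<open>Averages over squarefree numbers\<close>

definition no_square_upto :: "nat \<Rightarrow> nat \<Rightarrow> bool" where
  "no_square_upto D n \<longleftrightarrow> (\<forall>d\<in>{2..D}. \<not> d\<^sup>2 dvd n)"

lemma no_square_upto_periodic:
  "no_square_upto D (m * (fact D)\<^sup>2 + r) \<longleftrightarrow> no_square_upto D r"
proof -
  have "d\<^sup>2 dvd m * (fact D)\<^sup>2" if "d \<in> {2..D}" for d
    using that by (intro dvd_mult dvd_power_same dvd_fact) auto
  then show ?thesis by (auto simp: no_square_upto_def dvd_add_right_iff)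
qed

text \<open>The weight is constant on each residue class, so complete blocks reduce to sums along
  progressions. The incomplete last block has fewer than \<open>M\<close> terms, each at most
  \<open>B\<close>. The constant \<open>C\<close> must not depend on \<open>r\<close>.\<close>

lemma periodic_weight_sum_bound:
  fixes a :: "nat \<Rightarrow> complex" and w :: "nat \<Rightarrow> complex"
  assumes M: "0 < M" and w: "\<And>m r. w (m * M + r) = w r" "\<And>n. cmod (w n) \<le> 1"
    and a: "\<And>n. cmod (a n) \<le> B" and e: "0 \<le> e"
    and bnd: "\<And>r q. cmod (\<Sum>m<q. a (m * M + r)) \<le> real q * e + C"
  shows "cmod (\<Sum>n<N. a n * w n) \<le> real N * e + real M * (C + B)"
proof -
  define q where "q = N div M"
  have B: "0 \<le> B" using a[of 0] norm_ge_zero order_trans by blast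
  have qN: "q * M \<le> N" "N < q * M + M"
    using M dividend_less_div_times[of M N] by (auto simp: q_def)
  have eq: "(\<Sum>n<q * M. a n * w n) = (\<Sum>r<M. w r * (\<Sum>m<q. a (m * M + r)))"
  proof -
    have "(\<Sum>n<q * M. a n * w n) = (\<Sum>m<q. \<Sum>n\<in>{m * M..<m * M + M}. a n * w n)"
      by (rule sum.nat_group[symmetric])
    also have "\<dots> = (\<Sum>m<q. \<Sum>r<M. a (m * M + r) * w r)"
    proof (rule sum.cong[OF refl])
      fix m
      show "(\<Sum>n\<in>{m * M..<m * M + M}. a n * w n) = (\<Sum>r<M. a (m * M + r) * w r)"
        using sum.shift_bounds_nat_ivl[of "\<lambda>n. a n * w n" 0 "m * M" M]
        using w(1)[of m] by (simp add: add.commute lessThan_atLeast0)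
    qed
    also have "\<dots> = (\<Sum>r<M. w r * (\<Sum>m<q. a (m * M + r)))"
      by (subst sum.swap) (simp add: sum_distrib_left mult.commute)
    finally show ?thesis .
  qed
  have "cmod (\<Sum>n<q * M. a n * w n) \<le> (\<Sum>r<M. 1 * (real q * e + C))"
    unfolding eq
  proof (rule order_trans[OF norm_sum], rule sum_mono)
    fix r
    show "cmod (w r * (\<Sum>m<q. a (m * M + r))) \<le> 1 * (real q * e + C)"
      unfolding norm_mult by (intro mult_mono w bnd) auto
  qed
  then have 1: "cmod (\<Sum>n<q * M. a n * w n) \<le> real (q * M) * e + real M * C"
    by (simp add: algebra_simps)
  have "cmod (\<Sum>n\<in>{q * M..<N}. a n * w n) \<le> (\<Sum>n\<in>{q * M..<N}. B * 1)"
  proof (rule order_trans[OF norm_sum], rule sum_mono)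
    fix n
    show "cmod (a n * w n) \<le> B * 1"
      unfolding norm_mult using B by (intro mult_mono w a) auto
  qed
  also have "\<dots> = real (N - q * M) * B" by simp
  also have "\<dots> \<le> real M * B" using qN B by (intro mult_right_mono iffD2[OF of_nat_le_iff]) auto
  finally have 2: "cmod (\<Sum>n\<in>{q * M..<N}. a n * w n) \<le> real M * B" .
  have "(\<Sum>n<N. a n * w n) = (\<Sum>n<q * M. a n * w n) + (\<Sum>n\<in>{q * M..<N}. a n * w n)"
    unfolding lessThan_atLeast0 using qN by (intro sum.atLeastLessThan_concat[symmetric]) auto
  then have "cmod (\<Sum>n<N. a n * w n)
      \<le> cmod (\<Sum>n<q * M. a n * w n) + cmod (\<Sum>n\<in>{q * M..<N}. a n * w n)"
    by (simp only: norm_triangle_ineq)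
  also have "\<dots> \<le> (real (q * M) * e + real M * C) + real M * B" using 1 2 by (rule add_mono)
  also have "real (q * M) * e \<le> real N * e" using qN e by (intro mult_right_mono iffD2[OF of_nat_le_iff]) auto
  finally show ?thesis by (simp add: algebra_simps)
qed

lemma sum_inverse_squares_le:
  fixes D N :: nat
  assumes "1 \<le> D"
  shows "(\<Sum>d\<in>{D<..N}. 1 / (real d)\<^sup>2) \<le> 1 / real D"
proof (cases "D \<le> N")
  case True
  then have "(\<Sum>d\<in>{D<..N}. 1 / (real d)\<^sup>2) \<le> 1 / real D - 1 / real N"
  proof (induction N rule: dec_induct)
    case (step n)
    have n: "1 \<le> n" using step assms by simp
    have "{D<..Suc n} = insert (Suc n) {D<..n}" using step by auto
    then have "(\<Sum>d\<in>{D<..Suc n}. 1 / (real d)\<^sup>2)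
        = 1 / (real (Suc n))\<^sup>2 + (\<Sum>d\<in>{D<..n}. 1 / (real d)\<^sup>2)" by simp
    \<comment> \<open>Comparison with the telescoping series of 1 / (n (n + 1)).\<close>
    moreover have "1 / (real (Suc n))\<^sup>2 \<le> 1 / real n - 1 / real (Suc n)"
    proof -
      have "1 / (real (Suc n))\<^sup>2 \<le> 1 / (real n * real (Suc n))"
        using n unfolding power2_eq_square by (intro divide_left_mono mult_right_mono) auto
      also have "\<dots> = 1 / real n - 1 / real (Suc n)" using n by (simp add: field_simps)
      finally show ?thesis .
    qed
    ultimately show ?case using step by linarith
  qed simp
  also have "\<dots> \<le> 1 / real D" by simp
  finally show ?thesis .
qed simp

lemma card_multiples_le:
  fixes k N :: nat
  assumes "0 < k"
  shows "real (card {n\<in>{1..N}. k dvd n}) \<le> real N / real k"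
proof -
  have "{n\<in>{1..N}. k dvd n} \<subseteq> (\<lambda>m. k * m) ` {1..N div k}"
  proof
    fix n assume n: "n \<in> {n\<in>{1..N}. k dvd n}"
    then obtain m where m: "n = k * m" by blast
    then have "m \<le> N div k" using n assms by (simp add: less_eq_div_iff_mult_less_eq mult.commute)
    then show "n \<in> (\<lambda>m. k * m) ` {1..N div k}" using n m by auto
  qed
  then have "card {n\<in>{1..N}. k dvd n} \<le> card {1..N div k}"
    by (meson card_image_le card_mono finite_atLeastAtMost finite_imageI le_trans)
  then have "real (card {n\<in>{1..N}. k dvd n}) \<le> real (N div k)" by simp
  also have "\<dots> \<le> real N / real k" by (rule of_nat_div_le_of_nat)
  finally show ?thesis .
qed

text \<open>A square d^2 dividing such an \<open>n\<close> has \<open>d\<close> between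
  \<open>D\<close> and \<open>N\<close>, and at most N / d^2 numbers up to \<open>N\<close> are
  multiples of it; the tail of the series of inverse squares bounds the total.\<close>

lemma card_no_square_upto_not_squarefree_le:
  assumes D: "1 \<le> D"
  shows "real (card {n\<in>{1..N}. no_square_upto D n \<and> \<not> squarefree n}) \<le> real N / real D"
proof -
  have "{n\<in>{1..N}. no_square_upto D n \<and> \<not> squarefree n} \<subseteq> (\<Union>d\<in>{D<..N}. {n\<in>{1..N}. d\<^sup>2 dvd n})"
  proof
    fix n assume n: "n \<in> {n\<in>{1..N}. no_square_upto D n \<and> \<not> squarefree n}"
    then obtain d where d: "d\<^sup>2 dvd n" "d \<noteq> 1" by (auto simp: squarefree_def)
    have "d \<noteq> 0" using n d by (intro notI) auto
    then have "2 \<le> d" using d(2) by simp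
    then have "D < d" using n d(1) by (force simp: no_square_upto_def)
    moreover have "d \<le> N"
    proof -
      have "d \<le> d\<^sup>2" by (simp add: power2_eq_square)
      also have "\<dots> \<le> n" using n d(1) by (intro dvd_imp_le) auto
      finally show ?thesis using n by simp
    qed
    ultimately show "n \<in> (\<Union>d\<in>{D<..N}. {n\<in>{1..N}. d\<^sup>2 dvd n})" using n d(1) by auto
  qed
  then have "card {n\<in>{1..N}. no_square_upto D n \<and> \<not> squarefree n}
      \<le> card (\<Union>d\<in>{D<..N}. {n\<in>{1..N}. d\<^sup>2 dvd n})"
    by (intro card_mono) auto
  also have "\<dots> \<le> (\<Sum>d\<in>{D<..N}. card {n\<in>{1..N}. d\<^sup>2 dvd n})"
    by (rule card_UN_le) simp
  finally have "real (card {n\<in>{1..N}. no_square_upto D n \<and> \<not> squarefree n})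
      \<le> real (\<Sum>d\<in>{D<..N}. card {n\<in>{1..N}. d\<^sup>2 dvd n})"
    by (rule iffD2[OF of_nat_le_iff])
  also have "\<dots> = (\<Sum>d\<in>{D<..N}. real (card {n\<in>{1..N}. d\<^sup>2 dvd n}))" by (rule of_nat_sum)
  also have "\<dots> \<le> (\<Sum>d\<in>{D<..N}. real N * (1 / (real d)\<^sup>2))"
  proof (rule sum_mono)
    fix d assume "d \<in> {D<..N}"
    then show "real (card {n\<in>{1..N}. d\<^sup>2 dvd n}) \<le> real N * (1 / (real d)\<^sup>2)"
      using card_multiples_le[of "d\<^sup>2" N] by simp
  qed
  also have "\<dots> = real N * (\<Sum>d\<in>{D<..N}. 1 / (real d)\<^sup>2)" by (rule sum_distrib_left[symmetric])
  also have "\<dots> \<le> real N * (1 / real D)"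
    using sum_inverse_squares_le[OF D] by (rule mult_left_mono) simp
  finally show ?thesis by simp
qed

lemma moebius_squared: "(moebius n)\<^sup>2 = (if squarefree n then 1 else 0)"
  by (simp add: moebius_def power2_eq_square flip: power_mult_distrib)

theorem squarefree_average_tendsto_0:
  fixes a :: "nat \<Rightarrow> complex"
  assumes a: "\<And>n. cmod (a n) \<le> B"
    and prog: "\<And>M e. 0 < M \<Longrightarrow> 0 < e \<Longrightarrow>
      \<exists>C. \<forall>r q. cmod (\<Sum>m<q. a (m * M + r)) \<le> real q * e + C"
  shows "(\<lambda>N. 1 / of_nat N * (\<Sum>n=1..N. a n * of_int ((moebius n)\<^sup>2))) \<longlonglongrightarrow> 0"
proof (rule LIMSEQ_I)
  fix \<epsilon> :: real assume \<epsilon>: "0 < \<epsilon>"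
  have B: "0 \<le> B" using a[of 0] norm_ge_zero order_trans by blast
  \<comment> \<open>One share each goes to the periodic part, to the discarded numbers and to the
    constant \<open>K\<close>; the fourth makes the final inequality strict.\<close>
  define e where "e = \<epsilon> / 4"
  have e: "0 < e" using \<epsilon> by (simp add: e_def)
  obtain D :: nat where D: "1 \<le> D" "B / real D \<le> e"
  proof -
    obtain n :: nat where n: "B / e < real n" using reals_Archimedean2 by blast
    then have "B < real (Suc n) * e" using e by (simp add: field_simps)
    then have "B / real (Suc n) \<le> e" by (simp add: field_simps)
    then show thesis using that[of "Suc n"] by simp
  qed
  define M :: nat where "M = (fact D)\<^sup>2"
  have M: "0 < M" by (simp add: M_def)
  define w :: "nat \<Rightarrow> complex" where "w n = of_bool (no_square_upto D n)" for n
  obtain C where C: "\<And>r q. cmod (\<Sum>m<q. a (m * M + r)) \<le> real q * e + C"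
    using prog[OF M e] by blast
  \<comment> \<open>The periodic sum runs over \<open>n < Suc N\<close>: the extra \<open>e\<close>
    pays for the factor \<open>Suc N\<close> in place of \<open>N\<close>, and the last
    \<open>B\<close> for the term at 0.\<close>
  define K where "K = e + real M * (C + B) + B"
  have bound: "cmod (\<Sum>n=1..N. a n * of_int ((moebius n)\<^sup>2)) \<le> real N * (2 * e) + K" for N
  proof -
    have 1: "cmod (\<Sum>n<Suc N. a n * w n) \<le> real (Suc N) * e + real M * (C + B)"
      using M e a C by (intro periodic_weight_sum_bound)
        (auto simp: w_def M_def no_square_upto_periodic)
    have "{..<Suc N} = insert 0 {1..N}" by auto
    then have 2: "(\<Sum>n<Suc N. a n * w n) = a 0 * w 0 + (\<Sum>n=1..N. a n * w n)" by simp
    have 3: "cmod (a 0 * w 0) \<le> B" using a[of 0] B by (simp add: w_def norm_mult)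
    let ?E = "{n\<in>{1..N}. no_square_upto D n \<and> \<not> squarefree n}"
    have "(\<Sum>n=1..N. a n * w n) - (\<Sum>n=1..N. a n * of_int ((moebius n)\<^sup>2))
        = (\<Sum>n=1..N. if n \<in> ?E then a n else 0)"
      unfolding sum_subtractf[symmetric]
    proof (rule sum.cong[OF refl])
      fix n assume n: "n \<in> {1..N}"
      have "no_square_upto D n" if "squarefree n"
        using that by (fastforce simp: no_square_upto_def squarefree_def)
      then show "a n * w n - a n * of_int ((moebius n)\<^sup>2) = (if n \<in> ?E then a n else 0)"
        using n by (auto simp: w_def moebius_squared)
    qed
    also have "\<dots> = (\<Sum>n\<in>?E. a n)"
      by (subst sum.inter_filter[symmetric]) (auto intro!: sum.cong)
    finally have "cmod ((\<Sum>n=1..N. a n * w n) - (\<Sum>n=1..N. a n * of_int ((moebius n)\<^sup>2)))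
        \<le> real (card ?E) * B"
      using sum_norm_bound[of ?E a B] a by simp
    also have "\<dots> \<le> real N / real D * B"
      using card_no_square_upto_not_squarefree_le[OF D(1), of N] B by (rule mult_right_mono)
    also have "\<dots> \<le> real N * e"
      using mult_left_mono[OF D(2), of "real N"] by simp
    finally have 4: "cmod ((\<Sum>n=1..N. a n * w n) - (\<Sum>n=1..N. a n * of_int ((moebius n)\<^sup>2)))
        \<le> real N * e" .
    let ?L = "\<Sum>n=1..N. a n * of_int ((moebius n)\<^sup>2)" and ?X = "\<Sum>n<Suc N. a n * w n"
    let ?Y = "a 0 * w 0" and ?Z = "(\<Sum>n=1..N. a n * w n) - ?L"
    have eq: "?L = ?X - ?Y - ?Z" unfolding 2 by simp
    have "cmod ?L \<le> cmod ?X + cmod ?Y + cmod ?Z"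
      using norm_triangle_ineq4[of "?X - ?Y" ?Z] norm_triangle_ineq4[of ?X ?Y]
      unfolding eq[symmetric] by linarith
    then have "cmod ?L \<le> real (Suc N) * e + real M * (C + B) + B + real N * e"
      using 1 3 4 by linarith
    then show ?thesis by (simp add: K_def algebra_simps)
  qed
  obtain N0 :: nat where N0: "K / e < real N0" using reals_Archimedean2 by blast
  show "\<exists>no. \<forall>N\<ge>no. cmod (1 / of_nat N * (\<Sum>n=1..N. a n * of_int ((moebius n)\<^sup>2)) - 0) < \<epsilon>"
  proof (intro exI[of _ "Suc N0"] allI impI)
    fix N assume N: "Suc N0 \<le> N"
    then have "K / e < real N" using N0 by simp
    then have "K < real N * e" using e by (simp add: field_simps)
    then have "cmod (\<Sum>n=1..N. a n * of_int ((moebius n)\<^sup>2)) < real N * (2 * e) + real N * e"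
      using bound[of N] by linarith
    also have "\<dots> < real N * \<epsilon>" using N \<epsilon> by (simp add: e_def field_simps)
    finally have "cmod (\<Sum>n=1..N. a n * of_int ((moebius n)\<^sup>2)) / real N < \<epsilon>"
      using N by (simp add: field_simps)
    then show "cmod (1 / of_nat N * (\<Sum>n=1..N. a n * of_int ((moebius n)\<^sup>2)) - 0) < \<epsilon>"
      by (simp add: norm_mult norm_divide)
  qed
qed

section \<open>Uniform bounds for sums along orbits\<close>

lemma uniquely_ergodic_sum_bound_real:
  fixes S :: "'a::metric_space \<Rightarrow> 'a" and g :: "'a \<Rightarrow> real"
  assumes comp: "compact (UNIV :: 'a set)" and S: "continuous_on UNIV S"
    and uniq: "\<And>Q. ergodic_prob S Q \<Longrightarrow> Q = P"
    and g: "continuous_on UNIV g" "(LINT x|P. g x) = 0" and e: "0 < e"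
  shows "\<exists>C. \<forall>y q. (\<Sum>m<q. g ((S ^^ m) y)) \<le> real q * e + C"
proof -
  obtain Q where "ergodic_prob S Q" "(LINT x|Q. g x) = coboundary_sup S (Bcontfun g)"
    using ergodic_prob_maximizing[OF comp S g(1)] by blast
  \<comment> \<open>The maximizing ergodic measure can only be \<open>P\<close>, against which
    \<open>g\<close> integrates to 0.\<close>
  then have "coboundary_sup S (Bcontfun g) = 0" using uniq g(2) by metis
  then obtain u where u: "continuous_on UNIV u" and le: "\<And>x. g x + u x - u (S x) \<le> e"
    using coboundary_sup_attained[OF comp S g(1) e] by auto
  obtain b where b: "\<And>x. \<bar>u x\<bar> \<le> b"
    using compact_imp_bounded[OF compact_continuous_image[OF u comp]] by (auto simp: bounded_iff)
  \<comment> \<open>The coboundary telescopes along the orbit; its two end terms are bounded by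
    compactness, uniformly in \<open>y\<close> and \<open>q\<close>.\<close>
  have "(\<Sum>m<q. g ((S ^^ m) y)) \<le> real q * e - u y + u ((S ^^ q) y)" for y q
  proof (induction q)
    case (Suc q)
    then show ?case using le[of "(S ^^ q) y"] by (simp add: algebra_simps)
  qed simp
  moreover have "- u y + u z \<le> 2 * b" for y z using b[of y] b[of z] by linarith
  ultimately show ?thesis
    by (intro exI[of _ "2 * b"] allI) (smt (verit))
qed

text \<open>The real bound is one-sided, so it is applied to the real and imaginary parts and to
  their negatives, each of the two parts receiving \<open>e / 2\<close>.\<close>

lemma uniquely_ergodic_sum_bound:
  fixes S :: "'a::metric_space \<Rightarrow> 'a" and f :: "'a \<Rightarrow> complex"
  assumes comp: "compact (UNIV :: 'a set)" and S: "continuous_on UNIV S"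
    and uniq: "\<And>Q. ergodic_prob S Q \<Longrightarrow> Q = P" and P: "prob_space P" "sets P = sets borel"
    and f: "continuous_on UNIV f" "(LINT x|P. f x) = 0" and e: "0 < e"
  shows "\<exists>C. \<forall>y q. cmod (\<Sum>m<q. f ((S ^^ m) y)) \<le> real q * e + C"
proof -
  interpret prob_space P by (rule P(1))
  obtain b where "\<And>x. cmod (f x) \<le> b"
    using compact_imp_bounded[OF compact_continuous_image[OF f(1) comp]] by (auto simp: bounded_iff)
  then have int: "integrable P f"
    using borel_measurable_continuous_onI[OF f(1)] measurable_cong_sets[OF P(2) refl, of borel]
    by (intro integrable_const_bound[of _ b]) auto
  have Re: "(LINT x|P. Re (f x)) = 0" "(LINT x|P. - Re (f x)) = 0"
    and Im: "(LINT x|P. Im (f x)) = 0" "(LINT x|P. - Im (f x)) = 0"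
    using int f(2) by auto
  have e2: "0 < e / 2" using e by simp
  note bound = uniquely_ergodic_sum_bound_real[OF comp S uniq _ _ e2]
  obtain C1 where C1: "\<And>y q. (\<Sum>m<q. Re (f ((S ^^ m) y))) \<le> real q * (e / 2) + C1"
    using bound[OF _ continuous_on_Re[OF f(1)] Re(1)] by blast
  obtain C2 where C2: "\<And>y q. (\<Sum>m<q. - Re (f ((S ^^ m) y))) \<le> real q * (e / 2) + C2"
    using bound[OF _ continuous_on_minus[OF continuous_on_Re[OF f(1)]] Re(2)] by blast
  obtain C3 where C3: "\<And>y q. (\<Sum>m<q. Im (f ((S ^^ m) y))) \<le> real q * (e / 2) + C3"
    using bound[OF _ continuous_on_Im[OF f(1)] Im(1)] by blast
  obtain C4 where C4: "\<And>y q. (\<Sum>m<q. - Im (f ((S ^^ m) y))) \<le> real q * (e / 2) + C4"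
    using bound[OF _ continuous_on_minus[OF continuous_on_Im[OF f(1)]] Im(2)] by blast
  have "cmod (\<Sum>m<q. f ((S ^^ m) y)) \<le> real q * e + (max C1 C2 + max C3 C4)" for y q
  proof -
    let ?z = "\<Sum>m<q. f ((S ^^ m) y)"
    have "\<bar>Re ?z\<bar> \<le> real q * (e / 2) + max C1 C2"
      using C1[of y q] C2[of y q] by (simp add: sum_negf)
    moreover have "\<bar>Im ?z\<bar> \<le> real q * (e / 2) + max C3 C4"
      using C3[of y q] C4[of y q] by (simp add: sum_negf)
    ultimately show ?thesis using cmod_le[of ?z] by simp
  qed
  then show ?thesis by blast
qed

theorem theorem2p8:
  fixes T :: "'a::metric_space \<Rightarrow> 'a" and P :: "'a measure"
    and f :: "'a \<Rightarrow> complex" and x :: 'a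
  assumes "compact (UNIV :: 'a set)"
    and "\<exists>S. homeomorphism UNIV UNIV T S"
    and "uniquely_weakly_mixing T P"
    and "f \<in> C0 P"
  shows "(\<lambda>N::nat. 1 / of_nat N * (\<Sum>n=1..N. f ((T ^^ n) x) * of_int ((moebius n)\<^sup>2)))
           \<longlonglongrightarrow> 0"
proof -
  obtain S where hom: "homeomorphism UNIV UNIV T S" using assms(2) by blast
  then have T: "continuous_on UNIV T" and bij: "bij T"
    by (auto simp: homeomorphism_def intro!: o_bij[of S] simp: fun_eq_iff)
  have f: "continuous_on UNIV f" "(LINT x|P. f x) = 0" using assms(4) by (auto simp: C0_def)
  have P: "prob_space P" "sets P = sets borel"
    using assms(3) by (auto simp: uniquely_weakly_mixing_def ergodic_prob_def invariant_prob_def)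
  obtain b where b: "\<And>x. cmod (f x) \<le> b"
    using compact_imp_bounded[OF compact_continuous_image[OF f(1) assms(1)]]
    by (auto simp: bounded_iff)
  have TM: "continuous_on UNIV (T ^^ M)" for M
  proof (induction M)
    case (Suc n)
    then show ?case
      using continuous_on_compose[of UNIV "T ^^ n" T] continuous_on_subset[OF T] by simp
  qed (simp add: id_def)
  show ?thesis
  proof (rule squarefree_average_tendsto_0)
    show "cmod (f ((T ^^ n) x)) \<le> b" for n by (rule b)
    fix M :: nat and e :: real assume Me: "0 < M" "0 < e"
    have uniq: "Q = P" if "ergodic_prob (T ^^ M) Q" for Q
      using weakly_mixing_funpow_unique[OF assms(3) bij borel_measurable_continuous_onI[OF T] Me(1) that] .
    obtain C where C: "\<And>y q. cmod (\<Sum>m<q. f (((T ^^ M) ^^ m) y)) \<le> real q * e + C"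
      using uniquely_ergodic_sum_bound[OF assms(1) TM uniq P f Me(2)] by blast
    \<comment> \<open>A progression with residue \<open>r\<close> is an orbit of
      \<open>T ^^ M\<close> started at \<open>(T ^^ r) x\<close>; uniformity in the starting point
      makes one \<open>C\<close> serve all \<open>r\<close>.\<close>
    have "f ((T ^^ (m * M + r)) x) = f (((T ^^ M) ^^ m) ((T ^^ r) x))" for m r
      by (simp add: funpow_add funpow_mult mult.commute)
    then show "\<exists>C. \<forall>r q. cmod (\<Sum>m<q. f ((T ^^ (m * M + r)) x)) \<le> real q * e + C"
      by (intro exI[of _ C]) (simp add: C)
  qed
qed

end
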